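(* Let $p$ be an odd prime and let $m=pt$ be a (positive integer) multiple of $p$. There exists a nonabelian group $\mathcal{G}$ that contains a $(v,k,\lambda,\mu)$-partial difference set with $$v=p^{3m},$$ $$k=(p^m-1)((p-1)(p^m+1)+1),$$ $$\lambda=p^m-p+(p^{m+1}-p^m+p)(p-2),$$ $$\mu=(p^{m+1}-p^m+p)(p-1).$$
   Context: A subset $D$ of a finite group $G$ is a $(v,k,\lambda,\mu)$-partial difference set if $|G|=v$, $|D|=k$, every nonidentity $g\in D$ can be expressed as $d_1d_2^{-1}$ with $d_1,d_2\in D$ in exactly $\lambda$ ways, and every $g\in G\setminus(D\cup\{1\})$ can be so expressed in exactly $\mu$ ways. The displayed parameters are called Denniston parameters. *)

theory Defs
  imports "HOL-Algebra.Group" "HOL-Computational_Algebra.Primes"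
begin

definition partial_difference_set ::
  "('a, 'b) monoid_scheme \<Rightarrow> 'a set \<Rightarrow> nat \<Rightarrow> nat \<Rightarrow> nat \<Rightarrow> nat \<Rightarrow> bool" where
  "partial_difference_set G D v k l mu \<longleftrightarrow>
     group G \<and> finite (carrier G) \<and> D \<subseteq> carrier G \<and> card (carrier G) = v \<and> card D = k \<and>
     (\<forall>g \<in> D - {\<one>\<^bsub>G\<^esub>}.
        card {(d1, d2). d1 \<in> D \<and> d2 \<in> D \<and> g = d1 \<otimes>\<^bsub>G\<^esub> inv\<^bsub>G\<^esub> d2} = l) \<and>
     (\<forall>g \<in> carrier G - (D \<union> {\<one>\<^bsub>G\<^esub>}).
        card {(d1, d2). d1 \<in> D \<and> d2 \<in> D \<and> g = d1 \<otimes>\<^bsub>G\<^esub> inv\<^bsub>G\<^esub> d2} = mu)"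

end

theory Submission
  imports Defs "Jordan_Normal_Form.Char_Poly"
begin

text \<open>
  Put $q = p^m$, let $K \supset F$ be the fields of orders $q^2$ and $q$, and let
  $N(w) = w^{q+1}$ be the norm from $K$ to $F$. In the additive group $K \times F$ take the set
  $D$ of all $(0, l)$ with $l \neq 0$ together with the graphs of $cN$ over $K^*$, for all
  $c \in \mathbb{F}_p^*$.

  That $D$ is a partial difference set is shown by direct counting. For a translation by
  $(a, b)$, the points of the graph of $cN$ that are moved into the graph of $dN$ correspond to
  the solutions $w$ of $d N(w + a) = b + c N(w)$. For $c \neq d$, completing the square turns
  this into $N(u) = b(d - c) + cd N(a)$, which has $q + 1$ solutions, or one if the right-hand
  side is zero (\<open>card_norm_equation_neq\<close>); for $c = d$ and $a \neq 0$ it is a trace equation with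
  $q$ solutions (\<open>card_norm_equation_eq\<close>). When $a \neq 0$, the right-hand side can vanish only if
  $b / N(a)$ lies in $\mathbb{F}_p^*$, that is, if $(a, b) \in D$, and then it does so for $p - 2$ of
  the pairs $(c, d)$ (\<open>card_degenerate_pairs\<close>). After the contributions of the axis are added, the
  number of common points of $D$ and its translate depends only on whether $(a, b)$ belongs to $D$
  (\<open>card_translate_off_axis\<close>, \<open>card_translate_on_axis\<close>).

  The definition of $D$ involves only the norm and scalars from the prime field, so $D$ is invariant
  under the automorphism $\phi(x) = x^{p^{2t}}$ of $K$, acting on both coordinates. This
  automorphism has order $p$, because $2m = p \cdot 2t$; this is where divisibility of $m$ by $p$ enters. With
  the absolute trace $\tau : F \to \mathbb{F}_p$, which is invariant under $\phi$, the operation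
  $(w, l) * (w', l') = (w, l) + \phi^{\tau(l)}(w', l')$ is a nonabelian group structure on
  $K \times F$. Its left translations differ from the additive ones by automorphisms that preserve
  $D$, so $D$ remains a partial difference set (\<open>partial_difference_set_twisted_group\<close>).

  The field $K$ is constructed as $\mathbb{Z}[X]/M$ for a prime ideal $M$ that contains $p$ and all
  polynomials vanishing at a complex primitive root of unity of order $q^2 - 1$
  (\<open>exists_finite_residue_field\<close>). Such an ideal exists because $p$ is not
  invertible in the ring generated by that root of unity.
\<close>

section \<open>Groups that share their left translations up to automorphisms\<close>

lemma (in group) card_difference_representations:
  assumes D: "D \<subseteq> carrier G" and g: "g \<in> carrier G"
  shows "card {(d1, d2). d1 \<in> D \<and> d2 \<in> D \<and> g = d1 \<otimes> inv d2} = card {d \<in> D. g \<otimes> d \<in> D}"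
proof -
  have "g = d1 \<otimes> inv d2 \<longleftrightarrow> d1 = g \<otimes> d2" if "d1 \<in> D" "d2 \<in> D" for d1 d2
    using that D g by (metis inv_closed inv_solve_right subsetD)
  hence "d1 \<in> D \<and> d2 \<in> D \<and> g = d1 \<otimes> inv d2 \<longleftrightarrow> d2 \<in> D \<and> g \<otimes> d2 \<in> D \<and> d1 = g \<otimes> d2" for d1 d2
    by metis
  hence "{(d1, d2). d1 \<in> D \<and> d2 \<in> D \<and> g = d1 \<otimes> inv d2} =
      {(d1, d2). d2 \<in> D \<and> g \<otimes> d2 \<in> D \<and> d1 = g \<otimes> d2}" by simp
  also have "\<dots> = (\<lambda>d. (g \<otimes> d, d)) ` {d \<in> D. g \<otimes> d \<in> D}" by auto
  also have "card \<dots> = card {d \<in> D. g \<otimes> d \<in> D}"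
    by (intro card_image inj_onI) auto
  finally show ?thesis .
qed

text \<open>Since $g = d_1 d_2^{-1}$ says that left multiplication by $g$ carries $d_2$ to $d_1$, the
  condition only concerns the left translation action of the group on itself. This is the form in
  which the property can be compared between two groups that share their underlying set.\<close>

lemma partial_difference_set_iff_translates:
  "partial_difference_set G D v k l mu \<longleftrightarrow>
     group G \<and> finite (carrier G) \<and> D \<subseteq> carrier G \<and> card (carrier G) = v \<and> card D = k \<and>
     (\<forall>g \<in> D - {\<one>\<^bsub>G\<^esub>}. card {d \<in> D. g \<otimes>\<^bsub>G\<^esub> d \<in> D} = l) \<and>
     (\<forall>g \<in> carrier G - (D \<union> {\<one>\<^bsub>G\<^esub>}). card {d \<in> D. g \<otimes>\<^bsub>G\<^esub> d \<in> D} = mu)"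
proof (cases "group G \<and> D \<subseteq> carrier G")
  case True
  then interpret group G by simp
  have "card {(d1, d2). d1 \<in> D \<and> d2 \<in> D \<and> g = d1 \<otimes>\<^bsub>G\<^esub> inv\<^bsub>G\<^esub> d2} = card {d \<in> D. g \<otimes>\<^bsub>G\<^esub> d \<in> D}"
    if "g \<in> carrier G" for g
    using True that by (intro card_difference_representations) auto
  thus ?thesis unfolding partial_difference_set_def using True by (auto simp: subset_iff)
next
  case False
  thus ?thesis by (auto simp: partial_difference_set_def)
qed

text \<open>The twisting maps \<open>\<rho> x\<close> are those of a regular subgroup of the holomorph: when
  \<open>\<rho>\<close> is compatible with the product, the maps $y \mapsto x \cdot \rho_x(y)$ form a group acting
  regularly on the carrier.\<close>

definition twisted_group :: "('a, 'b) monoid_scheme \<Rightarrow> ('a \<Rightarrow> 'a \<Rightarrow> 'a) \<Rightarrow> 'a monoid" where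
  "twisted_group G \<rho> = \<lparr>carrier = carrier G, monoid.mult = (\<lambda>x y. x \<otimes>\<^bsub>G\<^esub> \<rho> x y), one = \<one>\<^bsub>G\<^esub>\<rparr>"

text \<open>Associativity is exactly the third hypothesis, which makes \<open>\<rho>\<close> a homomorphism from the new
  group to the automorphisms of the old one. Right inverses come from surjectivity of \<open>\<rho> x\<close>;
  they are left inverses because \<open>\<one>\<close> is neutral on both sides.\<close>

lemma (in group) twisted_group_is_group:
  assumes bij: "\<And>x. x \<in> carrier G \<Longrightarrow> bij_betw (\<rho> x) (carrier G) (carrier G)"
    and hom: "\<And>x y z. x \<in> carrier G \<Longrightarrow> y \<in> carrier G \<Longrightarrow> z \<in> carrier G \<Longrightarrow> \<rho> x (y \<otimes> z) = \<rho> x y \<otimes> \<rho> x z"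
    and comp: "\<And>x y z. x \<in> carrier G \<Longrightarrow> y \<in> carrier G \<Longrightarrow> z \<in> carrier G \<Longrightarrow> \<rho> (x \<otimes> \<rho> x y) z = \<rho> x (\<rho> y z)"
  shows "group (twisted_group G \<rho>)"
proof -
  let ?m = "\<lambda>x y. x \<otimes> \<rho> x y"
  have cl: "\<rho> x y \<in> carrier G" if "x \<in> carrier G" "y \<in> carrier G" for x y
    using bij[OF that(1)] that(2) by (auto simp: bij_betw_def)
  have \<rho>1: "\<rho> x \<one> = \<one>" if x: "x \<in> carrier G" for x
  proof -
    have "\<rho> x \<one> \<otimes> \<rho> x \<one> = \<rho> x \<one>" using hom[OF x one_closed one_closed] by simp
    thus ?thesis using cl[OF x one_closed] by (metis l_cancel_one)
  qed
  have id: "\<rho> \<one> y = y" if y: "y \<in> carrier G" for y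
  proof -
    have "\<rho> \<one> (\<rho> \<one> y) = \<rho> \<one> y" using comp[OF one_closed one_closed y] \<rho>1[OF one_closed] by simp
    thus ?thesis using bij[OF one_closed] y cl[OF one_closed y] by (auto simp: bij_betw_def inj_on_def)
  qed
  have assoc: "?m (?m x y) z = ?m x (?m y z)"
    if "x \<in> carrier G" "y \<in> carrier G" "z \<in> carrier G" for x y z
    using that cl by (simp add: comp hom m_assoc)
  have r_inv: "\<exists>y\<in>carrier G. ?m x y = \<one>" if x: "x \<in> carrier G" for x
  proof -
    obtain y where "y \<in> carrier G" "\<rho> x y = inv x"
      using bij[OF x] inv_closed[OF x] by (metis bij_betw_def imageE)
    thus ?thesis using x by (intro bexI[of _ y]) simp_all
  qed
  have l_inv: "\<exists>y\<in>carrier G. ?m y x = \<one>" if x: "x \<in> carrier G" for x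
  proof -
    obtain y where y: "y \<in> carrier G" "?m x y = \<one>" using r_inv[OF x] by auto
    obtain z where z: "z \<in> carrier G" "?m y z = \<one>" using r_inv[OF y(1)] by auto
    have "x = ?m x \<one>" using \<rho>1 x by simp
    also have "\<dots> = ?m (?m x y) z" using assoc[OF x y(1) z(1)] z(2) by simp
    also have "\<dots> = z" using y(2) id z(1) by simp
    finally show ?thesis using y z by auto
  qed
  show ?thesis
    by (rule groupI) (use cl assoc id l_inv in \<open>auto simp: twisted_group_def\<close>)
qed

text \<open>The new left translation by $g$ is the old one preceded by \<open>\<rho> g\<close>. As \<open>\<rho> g\<close> permutes
  $D$, it permutes the elements counted, so every count stays the same.\<close>

lemma partial_difference_set_twisted_group:
  assumes pds: "partial_difference_set G D v k l mu" and grp: "group (twisted_group G \<rho>)"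
    and inj: "\<And>x. x \<in> carrier G \<Longrightarrow> inj_on (\<rho> x) (carrier G)"
    and inv: "\<And>x. x \<in> carrier G \<Longrightarrow> \<rho> x ` D = D"
  shows "partial_difference_set (twisted_group G \<rho>) D v k l mu"
proof -
  have D: "D \<subseteq> carrier G" using pds by (simp add: partial_difference_set_def)
  have "card {d \<in> D. g \<otimes>\<^bsub>G\<^esub> \<rho> g d \<in> D} = card {d \<in> D. g \<otimes>\<^bsub>G\<^esub> d \<in> D}" if g: "g \<in> carrier G" for g
  proof -
    have "\<rho> g ` {d \<in> D. g \<otimes>\<^bsub>G\<^esub> \<rho> g d \<in> D} = {d \<in> D. g \<otimes>\<^bsub>G\<^esub> d \<in> D}"
      using inv[OF g] by auto
    moreover have "inj_on (\<rho> g) {d \<in> D. g \<otimes>\<^bsub>G\<^esub> \<rho> g d \<in> D}"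
      using inj[OF g] by (rule inj_on_subset) (use D in auto)
    hence "card (\<rho> g ` {d \<in> D. g \<otimes>\<^bsub>G\<^esub> \<rho> g d \<in> D}) = card {d \<in> D. g \<otimes>\<^bsub>G\<^esub> \<rho> g d \<in> D}" by (rule card_image)
    ultimately show ?thesis by simp
  qed
  hence eq: "card {d \<in> D. g \<otimes>\<^bsub>twisted_group G \<rho>\<^esub> d \<in> D} = card {d \<in> D. g \<otimes>\<^bsub>G\<^esub> d \<in> D}"
    if "g \<in> carrier G" for g
    using that by (simp add: twisted_group_def)
  have sel: "carrier (twisted_group G \<rho>) = carrier G" "\<one>\<^bsub>twisted_group G \<rho>\<^esub> = \<one>\<^bsub>G\<^esub>"
    by (simp_all add: twisted_group_def)
  show ?thesis
    unfolding partial_difference_set_iff_translates sel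
    using pds[unfolded partial_difference_set_iff_translates] grp eq D by (simp add: subset_eq)
qed

lemma partial_difference_set_copy_on_nat:
  fixes G :: "('a, 'b) monoid_scheme"
  assumes pds: "partial_difference_set G D v k l mu" and nc: "\<not> comm_group G"
  shows "\<exists>(H :: nat monoid) E. group H \<and> \<not> comm_group H \<and> partial_difference_set H E v k l mu"
proof -
  have grp: "group G" and fin: "finite (carrier G)" and D: "D \<subseteq> carrier G"
    using pds by (auto simp: partial_difference_set_def)
  interpret group G by (rule grp)
  obtain h :: "'a \<Rightarrow> nat" where inj: "inj_on h (carrier G)" using fin finite_imp_inj_to_nat_seg by blast
  define i where "i = inv_into (carrier G) h"
  have ih: "i (h x) = x" if "x \<in> carrier G" for x using inj that by (simp add: i_def)
  \<comment> \<open>transport of structure along an injection of the carrier into the natural numbers\<close>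
  define H :: "nat monoid" where
    "H = \<lparr>carrier = h ` carrier G, monoid.mult = (\<lambda>x y. h (i x \<otimes>\<^bsub>G\<^esub> i y)), one = h \<one>\<^bsub>G\<^esub>\<rparr>"
  have grpH: "group H"
  proof (rule groupI)
    fix x assume "x \<in> carrier H"
    then obtain y where "y \<in> carrier G" "x = h y" by (auto simp: H_def)
    thus "\<exists>y\<in>carrier H. y \<otimes>\<^bsub>H\<^esub> x = \<one>\<^bsub>H\<^esub>"
      by (auto simp: H_def ih intro!: bexI[of _ "inv\<^bsub>G\<^esub> y"])
  qed (auto simp: H_def ih m_assoc)
  have ncH: "\<not> comm_group H"
  proof
    assume "comm_group H"
    then interpret H: comm_group H .
    have "x \<otimes>\<^bsub>G\<^esub> y = y \<otimes>\<^bsub>G\<^esub> x" if "x \<in> carrier G" "y \<in> carrier G" for x y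
    proof -
      have "h (x \<otimes>\<^bsub>G\<^esub> y) = h (y \<otimes>\<^bsub>G\<^esub> x)"
        using H.m_comm[of "h x" "h y"] that by (simp add: H_def ih)
      thus ?thesis using inj that by (simp add: inj_on_eq_iff)
    qed
    hence "comm_group G" by (rule group_comm_groupI)
    thus False using nc by simp
  qed
  have mem: "h x \<in> h ` D \<longleftrightarrow> x \<in> D" if "x \<in> carrier G" for x
    using inj that D by (auto simp: inj_on_def subset_iff)
  have card_eq: "card {d \<in> h ` D. h g \<otimes>\<^bsub>H\<^esub> d \<in> h ` D} = card {d \<in> D. g \<otimes>\<^bsub>G\<^esub> d \<in> D}" if g: "g \<in> carrier G" for g
  proof -
    have "{d \<in> h ` D. h g \<otimes>\<^bsub>H\<^esub> d \<in> h ` D} = h ` {d \<in> D. g \<otimes>\<^bsub>G\<^esub> d \<in> D}"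
    proof -
      have "h g \<otimes>\<^bsub>H\<^esub> h d \<in> h ` D \<longleftrightarrow> g \<otimes>\<^bsub>G\<^esub> d \<in> D" if "d \<in> D" for d
        using D g that mem[of "g \<otimes>\<^bsub>G\<^esub> d"] by (simp add: H_def ih subset_iff)
      thus ?thesis by blast
    qed
    also have "card \<dots> = card {d \<in> D. g \<otimes>\<^bsub>G\<^esub> d \<in> D}"
      by (rule card_image, rule inj_on_subset[OF inj]) (use D in auto)
    finally show ?thesis .
  qed
  have "partial_difference_set H (h ` D) v k l mu"
    unfolding partial_difference_set_iff_translates
  proof (intro conjI ballI)
    show "card (carrier H) = v" "card (h ` D) = k"
      using pds inj D by (auto simp: partial_difference_set_def H_def card_image inj_on_subset)
  next
    fix g assume "g \<in> h ` D - {\<one>\<^bsub>H\<^esub>}"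
    then obtain x where "x \<in> D" "x \<noteq> \<one>\<^bsub>G\<^esub>" "g = h x" by (auto simp: H_def)
    thus "card {d \<in> h ` D. g \<otimes>\<^bsub>H\<^esub> d \<in> h ` D} = l"
      using pds D card_eq[of x] by (auto simp: partial_difference_set_iff_translates)
  next
    fix g assume "g \<in> carrier H - (h ` D \<union> {\<one>\<^bsub>H\<^esub>})"
    then obtain x where "x \<in> carrier G" "x \<notin> D" "x \<noteq> \<one>\<^bsub>G\<^esub>" "g = h x" by (auto simp: H_def)
    thus "card {d \<in> h ` D. g \<otimes>\<^bsub>H\<^esub> d \<in> h ` D} = mu"
      using pds D card_eq[of x] by (auto simp: partial_difference_set_iff_translates)
  qed (use grpH D fin in \<open>auto simp: H_def\<close>)
  thus ?thesis using grpH ncH by blast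
qed

section \<open>A prime ideal with a primitive root of unity\<close>

definition ring_ideal :: "'a::comm_ring_1 set \<Rightarrow> bool" where
  "ring_ideal I \<longleftrightarrow> 0 \<in> I \<and> (\<forall>x\<in>I. \<forall>y\<in>I. x + y \<in> I) \<and> (\<forall>x\<in>I. \<forall>r. r * x \<in> I)"

text \<open>By Zorn's lemma there is an ideal that is maximal among those containing $I$ but not $1$. It is
  prime: if it contained $xy$ but neither $x$ nor $y$, then adjoining $x$ would produce
  $1 = u + rx$, and multiplying by $y$ would give $y$.\<close>

lemma proper_ideal_subset_prime_ideal:
  fixes I :: "'a::comm_ring_1 set"
  assumes I: "ring_ideal I" "1 \<notin> I"
  obtains M where "ring_ideal M" "I \<subseteq> M" "1 \<notin> M" "\<And>x y. x * y \<in> M \<Longrightarrow> x \<in> M \<or> y \<in> M"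
proof -
  define S where "S = {J. ring_ideal J \<and> I \<subseteq> J \<and> 1 \<notin> J}"
  have "\<exists>M\<in>S. \<forall>X\<in>S. M \<subseteq> X \<longrightarrow> X = M"
  proof (rule subset_Zorn_nonempty)
    show "S \<noteq> {}" using I by (auto simp: S_def)
    fix C assume C: "C \<noteq> {}" "subset.chain S C"
    have CS: "\<And>J. J \<in> C \<Longrightarrow> J \<in> S" and ch: "\<And>J L. J \<in> C \<Longrightarrow> L \<in> C \<Longrightarrow> J \<subseteq> L \<or> L \<subseteq> J"
      using C(2) by (auto simp: subset_chain_def)
    obtain J0 where J0: "J0 \<in> C" using C(1) by auto
    have "ring_ideal (\<Union>C)"
      unfolding ring_ideal_def
    proof (intro conjI ballI allI)
      show "0 \<in> \<Union>C" using CS[OF J0] J0 by (auto simp: S_def ring_ideal_def)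
    next
      fix x y assume "x \<in> \<Union>C" "y \<in> \<Union>C"
      then obtain J L where JL: "J \<in> C" "L \<in> C" "x \<in> J" "y \<in> L" by auto
      from ch[OF JL(1,2)] obtain P where P: "P \<in> C" "x \<in> P" "y \<in> P" using JL by auto
      hence "x + y \<in> P" using CS[OF P(1)] by (auto simp: S_def ring_ideal_def)
      thus "x + y \<in> \<Union>C" using P(1) by auto
    next
      fix x r assume "x \<in> \<Union>C"
      thus "r * x \<in> \<Union>C" using CS by (fastforce simp: S_def ring_ideal_def)
    qed
    thus "\<Union>C \<in> S" using CS J0 by (fastforce simp: S_def)
  qed
  then obtain M where M: "M \<in> S" and max: "\<And>X. X \<in> S \<Longrightarrow> M \<subseteq> X \<Longrightarrow> X = M" by blast
  have Mid: "ring_ideal M" "I \<subseteq> M" "1 \<notin> M" using M by (auto simp: S_def)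
  have M_add: "\<And>u v. u \<in> M \<Longrightarrow> v \<in> M \<Longrightarrow> u + v \<in> M" and M_mult: "\<And>u r. u \<in> M \<Longrightarrow> r * u \<in> M"
    and M_0: "0 \<in> M"
    using Mid(1) by (auto simp: ring_ideal_def)
  have "x \<in> M \<or> y \<in> M" if xy: "x * y \<in> M" for x y
  proof (rule ccontr)
    assume neg: "\<not> (x \<in> M \<or> y \<in> M)"
    define J where "J = {u + r * x | u r. u \<in> M}"
    have MJ: "M \<subseteq> J" by (force simp: J_def intro: exI[of _ 0])
    have "x \<in> J" using M_0 by (force simp: J_def intro: exI[of _ 0] exI[of _ 1])
    hence "J \<noteq> M" using neg by auto
    have "ring_ideal J"
      unfolding ring_ideal_def
    proof (intro conjI ballI allI)
      show "0 \<in> J" using MJ M_0 by auto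
    next
      fix a b assume "a \<in> J" "b \<in> J"
      then obtain u r v s where "u \<in> M" "v \<in> M" "a = u + r * x" "b = v + s * x" by (auto simp: J_def)
      thus "a + b \<in> J" unfolding J_def using M_add[of u v]
        by (intro CollectI exI[of _ "u + v"] exI[of _ "r + s"]) (auto simp: algebra_simps)
    next
      fix a s assume "a \<in> J"
      then obtain u r where "u \<in> M" "a = u + r * x" by (auto simp: J_def)
      thus "s * a \<in> J" unfolding J_def using M_mult[of u s]
        by (intro CollectI exI[of _ "s * u"] exI[of _ "s * r"]) (auto simp: algebra_simps)
    qed
    hence "1 \<in> J" using max[of J] MJ \<open>J \<noteq> M\<close> Mid(2) by (auto simp: S_def)
    then obtain u r where ur: "u \<in> M" "1 = u + r * x" by (auto simp: J_def)
    have "y = y * (u + r * x)" using ur(2) by simp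
    also have "\<dots> = y * u + r * (x * y)" by (simp add: algebra_simps)
    also have "\<dots> \<in> M" by (intro M_add M_mult ur(1) xy)
    finally show False using neg by simp
  qed
  with Mid show ?thesis using that by blast
qed

lemma algebraic_int_eigenvalue_int_mat:
  fixes A :: "int mat" and \<alpha> :: complex
  assumes A: "A \<in> carrier_mat n n" and v: "v \<in> carrier_vec n" "v \<noteq> 0\<^sub>v n"
    and ev: "map_mat of_int A *\<^sub>v v = \<alpha> \<cdot>\<^sub>v v"
  shows "algebraic_int \<alpha>"
proof -
  let ?A = "map_mat of_int A :: complex mat"
  have cA: "?A \<in> carrier_mat n n" using A by simp
  have "eigenvalue ?A \<alpha>"
    unfolding eigenvalue_def eigenvector_def using A v ev by auto
  hence "poly (char_poly ?A) \<alpha> = 0" using eigenvalue_root_char_poly[OF cA] by simp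
  also have "char_poly ?A = map_poly of_int (char_poly A)"
    using of_int_hom.char_poly_hom[OF A] .
  finally have "poly (map_poly of_int (char_poly A)) \<alpha> = 0" .
  moreover have "lead_coeff (char_poly A) = 1" using degree_monic_char_poly[OF A] by simp
  ultimately show ?thesis unfolding algebraic_int_altdef_ipoly by blast
qed

text \<open>Multiplication by $f(\zeta)$ maps each $\zeta^j$ with $j < n$ to an integer combination of
  $1, \zeta, \ldots, \zeta^{n-1}$. Hence $f(\zeta)$ is an eigenvalue of an integer matrix, with
  eigenvector $(1, \zeta, \ldots, \zeta^{n-1})$.\<close>

lemma algebraic_int_int_poly_root_of_unity:
  fixes \<zeta> :: complex and f :: "int poly"
  assumes n: "n > 0" and z: "\<zeta> ^ n = 1"
  shows "algebraic_int (poly (of_int_poly f) \<zeta>)"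
proof -
  \<comment> \<open>row $j$ lists the coefficients of $\zeta^j f(\zeta)$, with exponents reduced by $\zeta^n = 1$\<close>
  define A where "A = mat n n (\<lambda>(j, k). \<Sum>i\<le>degree f. if (i + j) mod n = k then coeff f i else 0)"
  define v where "v = vec n (\<lambda>k. \<zeta> ^ k)"
  have "v $ 0 = 1" using n by (simp add: v_def)
  hence v0: "v \<noteq> 0\<^sub>v n" using n by auto
  have zmod: "\<zeta> ^ (i mod n) = \<zeta> ^ i" for i
  proof -
    have "\<zeta> ^ i = \<zeta> ^ (n * (i div n) + i mod n)" by simp
    also have "\<dots> = \<zeta> ^ (i mod n)" by (simp only: power_add power_mult z) simp
    finally show ?thesis by simp
  qed
  have "map_mat of_int A *\<^sub>v v = poly (of_int_poly f) \<zeta> \<cdot>\<^sub>v v"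
  proof (rule eq_vecI)
    fix j assume "j < dim_vec (poly (of_int_poly f) \<zeta> \<cdot>\<^sub>v v)"
    hence j: "j < n" by (simp add: v_def)
    have "(map_mat of_int A *\<^sub>v v) $ j =
        (\<Sum>k<n. (\<Sum>i\<le>degree f. if (i + j) mod n = k then of_int (coeff f i) else 0) * \<zeta> ^ k)"
      using j by (simp add: A_def v_def scalar_prod_def lessThan_atLeast0 if_distrib cong: if_cong)
    also have "\<dots> = (\<Sum>i\<le>degree f. \<Sum>k<n. if (i + j) mod n = k then of_int (coeff f i) * \<zeta> ^ k else 0)"
      unfolding sum_distrib_right by (subst sum.swap) (simp add: if_distribR if_distrib cong: if_cong)
    also have "\<dots> = (\<Sum>i\<le>degree f. of_int (coeff f i) * \<zeta> ^ ((i + j) mod n))"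
      using n by (intro sum.cong refl) (simp add: sum.delta')
    also have "\<dots> = (\<Sum>i\<le>degree f. of_int (coeff f i) * \<zeta> ^ i) * \<zeta> ^ j"
      by (simp only: zmod power_add sum_distrib_right mult.assoc)
    also have "\<dots> = poly (of_int_poly f) \<zeta> * \<zeta> ^ j"
      by (simp add: poly_altdef)
    finally show "(map_mat of_int A *\<^sub>v v) $ j = (poly (of_int_poly f) \<zeta> \<cdot>\<^sub>v v) $ j"
      using j by (simp add: v_def)
  qed (simp add: A_def v_def)
  thus ?thesis
    by (rule algebraic_int_eigenvalue_int_mat[rotated -1]) (use v0 in \<open>auto simp: A_def v_def\<close>)
qed

text \<open>An inverse of $p$ in $\mathbb{Z}[\zeta]$ would be a rational algebraic integer, hence an
  integer.\<close>

lemma nat_not_unit_at_root_of_unity: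
  fixes \<zeta> :: complex and f :: "int poly"
  assumes n: "n > 0" and z: "\<zeta> ^ n = 1" and "p > 1"
  shows "of_nat p * poly (of_int_poly f) \<zeta> \<noteq> 1"
proof
  assume eq: "of_nat p * poly (of_int_poly f) \<zeta> = 1"
  hence e: "poly (of_int_poly f) \<zeta> = 1 / of_nat p"
    using assms(3) by (simp add: field_simps)
  have "(1 / of_nat p :: complex) \<in> \<int>"
    using rational_algebraic_int_is_int[OF algebraic_int_int_poly_root_of_unity[OF n z, of f]] e by simp
  then obtain k where "(1 / of_nat p :: complex) = of_int k" by (auto elim: Ints_cases)
  hence "(of_int 1 :: complex) = of_int (k * int p)" using assms(3) by (simp add: field_simps)
  hence "k * int p = 1" by (simp only: of_int_eq_iff)
  hence "int p dvd 1" by (metis dvd_triv_right)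
  thus False using assms(3) by simp
qed

text \<open>Let $\zeta$ be a primitive complex $n$-th root of unity. The polynomials whose value at $\zeta$
  lies in $p\,\mathbb{Z}[\zeta]$ form a proper ideal, and $M$ is a prime ideal above it. The class
  of $X$ keeps order exactly $n$ modulo $M$: for $0 < i < n$ the sum $\sum_{j<n} \zeta^{ij}$
  vanishes, so $X^i \equiv 1$ would put $n$ into $M$, which together with
  $p \mid n + 1$ would give $1 \in M$.\<close>

lemma exists_prime_ideal_primitive_root:
  fixes p n :: nat
  assumes p: "prime p" and n: "n > 0" and pn: "p dvd Suc n"
  obtains M :: "int poly set" where "ring_ideal M" "1 \<notin> M" "\<And>x y. x * y \<in> M \<Longrightarrow> x \<in> M \<or> y \<in> M"
    "of_nat p \<in> M" "monom 1 n - 1 \<in> M" "\<And>i. 0 < i \<Longrightarrow> i < n \<Longrightarrow> monom 1 i - 1 \<notin> M"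
proof -
  define \<zeta> where "\<zeta> = cis (2 * pi / real n)"
  have zpow: "\<zeta> ^ i = cis (2 * pi * real i / real n)" for i
    by (simp add: \<zeta>_def DeMoivre mult_ac)
  have zn: "\<zeta> ^ n = 1" using n by (simp add: zpow)
  have zi: "\<zeta> ^ i \<noteq> 1" if i: "0 < i" "i < n" for i
  proof
    assume "\<zeta> ^ i = 1"
    hence "cis (2 * pi * real i / real n) = cis (2 * pi * real 0 / real n)" by (simp add: zpow)
    with bij_betw_imp_inj_on[OF bij_betw_roots_unity[OF n]] i n have "i = 0"
      by (auto simp: inj_on_def)
    thus False using i by simp
  qed
  define ev where "ev = (\<lambda>f. poly (of_int_poly f) \<zeta>)"
  have ev_simps: "ev (f + g) = ev f + ev g" "ev (f * g) = ev f * ev g" "ev (f - g) = ev f - ev g"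
    "ev 0 = 0" "ev 1 = 1" "ev (monom 1 i) = \<zeta> ^ i" for f g i
    by (auto simp: ev_def of_int_poly_hom.hom_add of_int_poly_hom.hom_mult of_int_poly_hom.hom_minus poly_monom)
  have ev_sum: "ev (sum h I) = (\<Sum>i\<in>I. ev (h i))" for h and I :: "nat set"
    by (induction I rule: infinite_finite_induct) (auto simp: ev_simps)
  \<comment> \<open>the kernel of evaluation modulo $p$; it contains $p$ and every polynomial that vanishes at $\zeta$\<close>
  define I where "I = {f. \<exists>g. ev f = of_nat p * ev g}"
  have "ring_ideal I"
    unfolding ring_ideal_def
  proof (intro conjI ballI allI)
    show "0 \<in> I" by (auto simp: I_def ev_simps intro!: exI[of _ 0])
  next
    fix x y assume "x \<in> I" "y \<in> I"
    then obtain g h where "ev x = of_nat p * ev g" "ev y = of_nat p * ev h" by (auto simp: I_def)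
    thus "x + y \<in> I" by (auto simp: I_def ev_simps algebra_simps intro!: exI[of _ "g + h"])
  next
    fix x r assume "x \<in> I"
    then obtain g where "ev x = of_nat p * ev g" by (auto simp: I_def)
    thus "r * x \<in> I" by (auto simp: I_def ev_simps algebra_simps intro!: exI[of _ "r * g"])
  qed
  moreover have "1 \<notin> I"
    using nat_not_unit_at_root_of_unity[OF n zn prime_gt_1_nat[OF p]]
    by (auto simp: I_def ev_simps) (metis ev_def)
  ultimately obtain M where M: "ring_ideal M" "I \<subseteq> M" "1 \<notin> M"
      and pr: "\<And>x y. x * y \<in> M \<Longrightarrow> x \<in> M \<or> y \<in> M"
    by (rule proper_ideal_subset_prime_ideal) blast
  have ker: "f \<in> M" if "ev f = 0" for f
    using that M(2) by (auto simp: I_def ev_simps intro!: exI[of _ 0])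
  have M_add: "\<And>u v. u \<in> M \<Longrightarrow> v \<in> M \<Longrightarrow> u + v \<in> M" and M_mult: "\<And>u r. u \<in> M \<Longrightarrow> r * u \<in> M"
    and M_0: "0 \<in> M"
    using M(1) by (auto simp: ring_ideal_def)
  have pM: "of_nat p \<in> M"
  proof -
    have "ev (of_nat k) = of_nat k" for k by (induction k) (simp_all add: ev_simps)
    thus ?thesis using M(2) by (auto simp: I_def ev_simps intro!: exI[of _ 1])
  qed
  have "monom 1 i - 1 \<notin> M" if i: "0 < i" "i < n" for i
  proof
    assume a: "monom 1 i - 1 \<in> M"
    have "ev (\<Sum>j<n. monom 1 (i * j)) = (\<Sum>j<n. (\<zeta> ^ i) ^ j)"
      by (simp add: ev_sum ev_simps power_mult)
    also have "\<dots> = ((\<zeta> ^ i) ^ n - 1) / (\<zeta> ^ i - 1)" using zi[OF i] by (rule geometric_sum)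
    also have "(\<zeta> ^ i) ^ n = 1" using zn by (metis power_mult power_one mult.commute)
    finally have S: "(\<Sum>j<n. monom 1 (i * j)) \<in> M" by (intro ker) simp
    have "(\<Sum>j<k. monom 1 (i * j)) - of_nat k \<in> M" for k
    proof (induction k)
      case (Suc k)
      have "monom 1 (i * k) - 1 = (monom 1 i :: int poly) ^ k - 1" by (simp add: monom_power)
      also have "\<dots> = (\<Sum>j<k. monom 1 i ^ j) * (monom 1 i - 1)"
        by (simp add: power_diff_1_eq mult.commute)
      also have "\<dots> \<in> M" using a by (rule M_mult)
      finally have "((\<Sum>j<k. monom 1 (i * j)) - of_nat k) + (monom 1 (i * k) - 1) \<in> M"
        using Suc.IH by (intro M_add)
      thus ?case by (simp add: algebra_simps)
    qed (simp add: M_0)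
    from M_add[OF S M_mult[OF this[of n], of "-1"]] have nM: "of_nat n \<in> M" by simp
    obtain c where "Suc n = p * c" using pn by auto
    hence "of_nat (Suc n) \<in> M" using M_mult[OF pM, of "of_nat c"] by (metis of_nat_mult mult.commute)
    from M_add[OF this M_mult[OF nM, of "-1"]] have "1 \<in> M" by simp
    thus False using M(3) by simp
  qed
  moreover have "monom 1 n - 1 \<in> M" by (rule ker) (simp add: ev_simps zn)
  ultimately show ?thesis using that M(1,3) pr pM by blast
qed

section \<open>Residue fields of integer polynomials\<close>

text \<open>If the upper bounds on the number of fibres and on their sizes multiply to the size of the domain,
  then all of them are attained. In the finite fields below this turns bounds for numbers of roots of
  polynomials into exact counts.\<close>

lemma fibre_cards_exact:
  assumes "finite A" "finite B" "f ` A \<subseteq> B" and A: "card A = b * d" and B: "card B \<le> b" and "d > 0"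
    and le: "\<And>y. y \<in> B \<Longrightarrow> card {x \<in> A. f x = y} \<le> d"
  shows "card B = b" and "\<And>y. y \<in> B \<Longrightarrow> card {x \<in> A. f x = y} = d"
proof -
  have eq: "card A = (\<Sum>y\<in>B. card {x \<in> A. f x = y})"
    using sum_card_image[of A] sum.group[OF assms(1,2,3), of "\<lambda>_. 1::nat"] by simp
  also have "\<dots> \<le> card B * d" using sum_bounded_above[of B _ d] le by simp
  finally have "b * d \<le> card B * d" using A by simp
  thus cB: "card B = b" using B \<open>d > 0\<close> by simp
  show "card {x \<in> A. f x = y} = d" if y: "y \<in> B" for y
  proof (rule ccontr)
    assume "card {x \<in> A. f x = y} \<noteq> d"
    hence "card {x \<in> A. f x = y} < d" using le[OF y] by simp
    hence "(\<Sum>y\<in>B. card {x \<in> A. f x = y}) < (\<Sum>y\<in>B. d)"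
      using y le \<open>finite B\<close> by (intro sum_strict_mono_ex1) auto
    thus False using eq A cB by simp
  qed
qed

lemma monic_monom_add:
  fixes g :: "'a::comm_ring_1 poly"
  assumes "degree g < n"
  shows "degree (monom 1 n + g) = n" "lead_coeff (monom 1 n + g) = 1"
proof -
  show d: "degree (monom 1 n + g) = n"
    using assms by (simp add: degree_add_eq_left degree_monom_eq)
  show "lead_coeff (monom 1 n + g) = 1"
    unfolding d using assms by (simp add: coeff_eq_0)
qed

text \<open>The field of order $p^N$ occurs as the residue ring of a prime ideal $M$ in a ring that forms a
  whole type. Computations take place in that ring, modulo $M$; this needs neither a quotient type,
  which could not depend on $p$, nor closure conditions for a carrier.\<close>

locale residue_domain =
  fixes M :: "'a::comm_ring_1 set" and p :: nat
  assumes ideal: "ring_ideal M" and one_notin: "1 \<notin> M"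
    and prime_ideal: "x * y \<in> M \<Longrightarrow> x \<in> M \<or> y \<in> M"
    and prime_p: "prime p" and p_in: "of_nat p \<in> M"
begin

definition cong (infix "\<approx>" 50) where "x \<approx> y \<longleftrightarrow> x - y \<in> M"

lemma M_add: "x \<in> M \<Longrightarrow> y \<in> M \<Longrightarrow> x + y \<in> M" and M_mult: "x \<in> M \<Longrightarrow> r * x \<in> M" and M_0: "0 \<in> M"
  using ideal by (auto simp: ring_ideal_def)

lemma cong_refl [simp, intro]: "x \<approx> x" by (simp add: cong_def M_0)

lemma cong_sym: "x \<approx> y \<Longrightarrow> y \<approx> x"
  using M_mult[of "x - y" "-1"] by (simp add: cong_def)

lemma cong_sym_iff: "x \<approx> y \<longleftrightarrow> y \<approx> x" using cong_sym by blast

lemma cong_trans [trans]: "x \<approx> y \<Longrightarrow> y \<approx> z \<Longrightarrow> x \<approx> z"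
  using M_add[of "x - y" "y - z"] by (simp add: cong_def)

lemma cong_eq_trans [trans]: "x \<approx> y \<Longrightarrow> y = z \<Longrightarrow> x \<approx> z" "x = y \<Longrightarrow> y \<approx> z \<Longrightarrow> x \<approx> z"
  by auto

lemma cong_iff: "x \<approx> x' \<Longrightarrow> y \<approx> y' \<Longrightarrow> x \<approx> y \<longleftrightarrow> x' \<approx> y'"
  by (meson cong_sym cong_trans)

lemma cong_add: "x \<approx> x' \<Longrightarrow> y \<approx> y' \<Longrightarrow> x + y \<approx> x' + y'"
  using M_add[of "x - x'" "y - y'"] by (simp add: cong_def algebra_simps)

lemma cong_minus: "x \<approx> x' \<Longrightarrow> - x \<approx> - x'"
  using M_mult[of "x - x'" "-1"] by (simp add: cong_def)

lemma cong_diff: "x \<approx> x' \<Longrightarrow> y \<approx> y' \<Longrightarrow> x - y \<approx> x' - y'"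
  using cong_add[OF _ cong_minus, of x x' y y'] by simp

lemma cong_mult: "x \<approx> x' \<Longrightarrow> y \<approx> y' \<Longrightarrow> x * y \<approx> x' * y'"
  using M_add[of "y * (x - x')" "x' * (y - y')"] M_mult[of "x - x'" y] M_mult[of "y - y'" x']
  by (simp add: cong_def algebra_simps)

lemma cong_power: "x \<approx> x' \<Longrightarrow> x ^ n \<approx> x' ^ n"
  by (induction n) (auto intro: cong_mult)

lemma cong_sum: "(\<And>i. i \<in> I \<Longrightarrow> h i \<approx> h' i) \<Longrightarrow> sum h I \<approx> sum h' I"
  by (induction I rule: infinite_finite_induct) (auto intro: cong_add)

lemma cong_0_iff: "x \<approx> 0 \<longleftrightarrow> x \<in> M" by (simp add: cong_def)

lemma cong_diff_0: "x - y \<approx> 0 \<longleftrightarrow> x \<approx> y" by (simp add: cong_def)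

lemma not_1_cong_0 [simp]: "\<not> 1 \<approx> 0" using one_notin by (simp add: cong_0_iff)

lemma mult_cong_0_iff: "x * y \<approx> 0 \<longleftrightarrow> x \<approx> 0 \<or> y \<approx> 0"
  using prime_ideal[of x y] M_mult[of x y] M_mult[of y x] by (auto simp: cong_0_iff mult.commute)

lemma mult_cong_0: "x \<approx> 0 \<Longrightarrow> y * x \<approx> 0" "x \<approx> 0 \<Longrightarrow> x * y \<approx> 0"
  by (auto simp: mult_cong_0_iff)

lemma power_cong_0_iff: "n > 0 \<Longrightarrow> x ^ n \<approx> 0 \<longleftrightarrow> x \<approx> 0"
  by (induction n rule: nat_induct_non_zero) (auto simp: mult_cong_0_iff)

lemma mult_cong_cancel: "\<not> c \<approx> 0 \<Longrightarrow> c * x \<approx> c * y \<longleftrightarrow> x \<approx> y"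
  by (metis cong_diff_0 mult_cong_0_iff right_diff_distrib)

lemma frobenius_add: "(x + y) ^ (p ^ k) \<approx> x ^ (p ^ k) + y ^ (p ^ k)"
proof (induction k)
  case (Suc k)
  have step: "(u + v) ^ p \<approx> u ^ p + v ^ p" for u v
  proof -
    have p2: "p \<ge> 2" using prime_p by (simp add: prime_ge_2_nat)
    have "(u + v) ^ p = (\<Sum>i\<le>p. of_nat (p choose i) * u ^ i * v ^ (p - i))" by (rule binomial_ring)
    also have "\<dots> \<approx> (\<Sum>i\<le>p. (if i = 0 then v ^ p else 0) + (if i = p then u ^ p else 0))"
    proof (rule cong_sum)
      fix i assume i: "i \<in> {..p}"
      show "of_nat (p choose i) * u ^ i * v ^ (p - i)
          \<approx> (if i = 0 then v ^ p else 0) + (if i = p then u ^ p else 0)"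
      proof (cases "i = 0 \<or> i = p")
        case True thus ?thesis using p2 by auto
      next
        case False
        hence "p dvd (p choose i)" using i prime_p by (intro dvd_choose_prime) auto
        then obtain r where r: "p choose i = p * r" by auto
        have "of_nat (p choose i) \<approx> 0"
          unfolding r of_nat_mult using p_in by (intro mult_cong_0) (simp add: cong_0_iff)
        thus ?thesis using False by (simp add: mult_cong_0)
      qed
    qed
    also have "\<dots> = u ^ p + v ^ p" by (simp add: sum.distrib)
    finally show ?thesis .
  qed
  have "(x + y) ^ (p ^ Suc k) = ((x + y) ^ (p ^ k)) ^ p" by (simp flip: power_mult add: mult.commute)
  also have "\<dots> \<approx> (x ^ (p ^ k) + y ^ (p ^ k)) ^ p" by (intro cong_power Suc)
  also have "\<dots> \<approx> x ^ (p ^ Suc k) + y ^ (p ^ Suc k)"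
    using step[of "x ^ (p ^ k)" "y ^ (p ^ k)"] by (simp flip: power_mult add: mult.commute)
  finally show ?case .
qed auto

lemma of_nat_power_p: "of_nat c ^ (p ^ k) \<approx> of_nat c"
proof (induction c)
  case 0
  have "p ^ k > 0" using prime_p by (simp add: prime_gt_0_nat)
  thus ?case by (simp add: power_0_left)
next
  case (Suc c)
  have "of_nat (Suc c) ^ (p ^ k) \<approx> 1 ^ (p ^ k) + of_nat c ^ (p ^ k)"
    unfolding of_nat_Suc by (rule frobenius_add)
  also have "\<dots> \<approx> 1 + of_nat c" using Suc by (intro cong_add) auto
  finally show ?case by simp
qed

lemma frobenius_minus: "(- x) ^ (p ^ k) \<approx> - (x ^ (p ^ k))"
proof -
  have p0: "p ^ k > 0" using prime_p by (simp add: prime_gt_0_nat)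
  have "x ^ (p ^ k) + (- x) ^ (p ^ k) \<approx> (x + - x) ^ (p ^ k)"
    by (rule cong_sym[OF frobenius_add])
  also have "\<dots> = 0" using p0 by (simp add: power_0_left)
  finally show ?thesis by (simp add: cong_def add.commute)
qed

lemma frobenius_diff: "(x - y) ^ (p ^ k) \<approx> x ^ (p ^ k) - y ^ (p ^ k)"
  using cong_trans[OF frobenius_add[of x "- y" k] cong_add[OF cong_refl frobenius_minus]] by simp

lemma frobenius_sum: "(\<Sum>i\<in>I. h i) ^ (p ^ k) \<approx> (\<Sum>i\<in>I. h i ^ (p ^ k))"
proof (induction I rule: infinite_finite_induct)
  case (insert i I)
  thus ?case using cong_trans[OF frobenius_add cong_add[OF cong_refl insert.IH]] by simp
qed (use prime_p in \<open>auto simp: power_0_left prime_gt_0_nat\<close>)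

lemma of_int_cong_0_iff: "of_int i \<approx> 0 \<longleftrightarrow> int p dvd i"
proof
  assume "int p dvd i"
  then obtain r where "i = r * int p" by (metis dvd_def mult.commute)
  hence "of_int i = (of_int r :: 'a) * of_nat p" by simp
  thus "of_int i \<approx> 0" using p_in by (metis mult_cong_0(1) cong_0_iff)
next
  assume a: "of_int i \<approx> 0"
  show "int p dvd i"
  proof (rule ccontr)
    assume "\<not> int p dvd i"
    hence "coprime i (int p)" using prime_p
      by (metis coprime_commute prime_imp_coprime prime_nat_int_transfer)
    then obtain u v where "u * i + v * int p = 1" by (metis bezout_int coprime_imp_gcd_eq_1)
    hence "(1 :: 'a) = of_int (u * i + v * int p)" by simp
    also have "\<dots> = of_int u * of_int i + of_int v * of_nat p" by simp
    also have "\<dots> \<approx> 0 + 0"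
      using a p_in by (intro cong_add mult_cong_0) (auto simp: cong_0_iff)
    finally show False by simp
  qed
qed

lemma of_nat_cong_iff: "of_nat i \<approx> of_nat j \<longleftrightarrow> int p dvd int i - int j"
  using of_int_cong_0_iff[of "int i - int j"] by (simp add: cong_diff_0)

lemma of_nat_cong_imp_eq: "of_nat i \<approx> of_nat j \<Longrightarrow> i < p \<Longrightarrow> j < p \<Longrightarrow> i = j"
  unfolding of_nat_cong_iff by (metis mod_eq_dvd_iff nat_int mod_pos_pos_trivial of_nat_0_le_iff of_nat_less_iff)

lemma of_nat_not_cong_0: "0 < i \<Longrightarrow> i < p \<Longrightarrow> \<not> of_nat i \<approx> 0"
  using of_nat_cong_imp_eq[of i 0] by auto

text \<open>This is the usual bound by the degree, for polynomials over the domain obtained by factoring out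
  $M$: split off a root $a$ by synthetic division; since $M$ is prime, every further root is a root
  of the quotient.\<close>

lemma card_roots_le:
  assumes "lead_coeff f = 1" "finite S" "\<And>x. x \<in> S \<Longrightarrow> poly f x \<approx> 0"
    and "\<And>x y. x \<in> S \<Longrightarrow> y \<in> S \<Longrightarrow> x \<approx> y \<Longrightarrow> x = y"
  shows "card S \<le> degree f"
  using assms
proof (induction "degree f" arbitrary: f S)
  case 0
  then obtain c where "f = [:c:]" by (metis degree_eq_zeroE)
  hence "S = {}" using 0 by fastforce
  thus ?case by simp
next
  case (Suc d)
  show ?case
  proof (cases "S = {}")
    case False
    then obtain a where a: "a \<in> S" by auto
    define g where "g = synthetic_div f a"
    have f: "[:- a, 1:] * g + [:poly f a:] = f" unfolding g_def by (rule synthetic_div_correct')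
    have dg: "degree g = d" using Suc(2) by (simp add: g_def degree_synthetic_div)
    have "coeff f (Suc d) = coeff g d - a * coeff g (Suc d)"
      by (subst f[symmetric]) simp
    also have "coeff g (Suc d) = 0" using dg by (intro coeff_eq_0) simp
    finally have lg: "lead_coeff g = 1" using Suc(2,3) dg by simp
    have "poly g x \<approx> 0" if x: "x \<in> S - {a}" for x
    proof -
      have "poly f x = (x - a) * poly g x + poly f a"
        by (subst (1) f[symmetric]) (simp add: algebra_simps)
      hence "(x - a) * poly g x = poly f x - poly f a" by simp
      also have "\<dots> \<approx> 0 - 0" using Suc x a by (intro cong_diff) auto
      finally have "x \<approx> a \<or> poly g x \<approx> 0" by (simp add: mult_cong_0_iff cong_diff_0)
      thus ?thesis using Suc(6)[of x a] x a by auto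
    qed
    hence "card (S - {a}) \<le> degree g"
      using Suc lg dg by (intro Suc(1)) auto
    thus ?thesis using a Suc(2,4) dg by simp
  qed simp
qed

text \<open>A choice of one representative in each congruence class; the set \<open>K\<close> of all representatives
  stands for the residue ring, so that elements can be counted.\<close>

definition rep :: "'a \<Rightarrow> 'a" where "rep x = (SOME y. y \<approx> x)"

lemma rep_cong [simp, intro]: "rep x \<approx> x"
  unfolding rep_def by (rule someI[of _ x]) simp

lemma rep_eq_iff: "rep x = rep y \<longleftrightarrow> x \<approx> y"
proof
  assume "rep x = rep y" thus "x \<approx> y" using rep_cong by (metis cong_sym cong_trans)
next
  assume "x \<approx> y"
  hence "(\<lambda>z. z \<approx> x) = (\<lambda>z. z \<approx> y)" by (auto intro: cong_trans cong_sym)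
  thus "rep x = rep y" by (simp add: rep_def)
qed

definition K :: "'a set" where "K = range rep"

lemma rep_in_K [simp, intro]: "rep x \<in> K" by (simp add: K_def)

lemma rep_K: "x \<in> K \<Longrightarrow> rep x = x" by (auto simp: K_def rep_eq_iff)

lemma K_eqI: "x \<in> K \<Longrightarrow> y \<in> K \<Longrightarrow> x \<approx> y \<Longrightarrow> x = y" using rep_K rep_eq_iff by metis

lemma rep_cong_iff [simp]: "rep x \<approx> y \<longleftrightarrow> x \<approx> y" "y \<approx> rep x \<longleftrightarrow> y \<approx> x"
  by (meson rep_cong cong_sym cong_trans)+

lemma card_roots_in_K_le:
  assumes "finite K" "lead_coeff f = 1" "S \<subseteq> K" "\<And>x. x \<in> S \<Longrightarrow> poly f x \<approx> 0"
  shows "card S \<le> degree f"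
  using assms by (intro card_roots_le) (auto intro: finite_subset K_eqI)

text \<open>There are at most $n + 1$ classes because all of them are roots of $X^{n+1} - X$; on the other
  hand $0, 1, z, \ldots, z^{n-1}$ are incongruent.\<close>

lemma card_K_primitive_root:
  assumes pow: "\<And>x. x ^ Suc n \<approx> x" and n: "n > 0"
    and zn: "z ^ n \<approx> 1" and zi: "\<And>i. 0 < i \<Longrightarrow> i < n \<Longrightarrow> \<not> z ^ i \<approx> 1"
  shows "card K = Suc n"
proof -
  have nz: "\<not> z ^ i \<approx> 0" for i
  proof
    assume "z ^ i \<approx> 0"
    hence "z \<approx> 0" by (cases "i > 0") (auto simp: power_cong_0_iff)
    hence "z ^ n \<approx> 0" using n by (simp only: power_cong_0_iff)
    thus False using zn not_1_cong_0 cong_sym cong_trans by blast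
  qed
  have nz': "\<not> 0 \<approx> z ^ i" for i using nz cong_sym by blast
  have *: "\<not> z ^ i \<approx> z ^ j" if "i < j" "j < n" for i j
  proof
    assume "z ^ i \<approx> z ^ j"
    hence "z ^ i * 1 \<approx> z ^ i * z ^ (j - i)" using that by (simp flip: power_add)
    hence "z ^ (j - i) \<approx> 1" using mult_cong_cancel[OF nz] cong_sym by blast
    thus False using zi[of "j - i"] that by simp
  qed
  have inj: "inj_on (\<lambda>i. rep (z ^ i)) {..<n}"
    by (rule inj_onI) (metis * rep_eq_iff lessThan_iff nat_neq_iff cong_sym)
  have d: "degree (- monom 1 1 :: 'a poly) < Suc n" using n by (simp add: degree_monom_eq)
  have bound: "card S \<le> Suc n" if "S \<subseteq> K" "finite S" for S
  proof -
    have "card S \<le> degree (monom 1 (Suc n) + - monom 1 1 :: 'a poly)"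
    proof (rule card_roots_le[OF monic_monom_add(2)[OF d] that(2)])
      show "poly (monom 1 (Suc n) + - monom 1 1) x \<approx> 0" for x
        using pow[of x] by (simp add: poly_monom cong_diff_0)
    qed (use that in \<open>auto intro: K_eqI\<close>)
    thus ?thesis using monic_monom_add(1)[OF d] by simp
  qed
  have fin: "finite K"
  proof (rule ccontr)
    assume "infinite K"
    then obtain S where "S \<subseteq> K" "finite S" "card S = Suc (Suc n)"
      by (metis infinite_arbitrarily_large)
    thus False using bound[of S] by simp
  qed
  have "Suc n = card (insert (rep 0) ((\<lambda>i. rep (z ^ i)) ` {..<n}))"
    using inj nz' by (subst card_insert_disjoint) (auto simp: card_image rep_eq_iff)
  also have "\<dots> \<le> card K" using fin by (intro card_mono) auto
  finally show ?thesis using bound[of K] fin by simp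
qed

end

text \<open>Every integer polynomial satisfies $x^{p^N} \equiv x$, because the Frobenius map is additive and the
  relation holds for integers and for $X$, whose $(p^N - 1)$-th power is congruent to $1$.\<close>

theorem exists_finite_residue_field:
  fixes p N :: nat
  assumes p: "prime p" and N: "N > 0"
  obtains M :: "int poly set" where "residue_domain M p" "\<And>x. residue_domain.cong M (x ^ (p ^ N)) x"
    "card (residue_domain.K M) = p ^ N"
proof -
  define n where "n = p ^ N - 1"
  have "p ^ N > 1" using prime_gt_1_nat[OF p] N by (intro one_less_power)
  hence n: "n > 0" "Suc n = p ^ N" by (auto simp: n_def)
  have "p dvd Suc n" using N n(2) by (simp add: dvd_power)
  then obtain M :: "int poly set" where M: "ring_ideal M" "1 \<notin> M"
      "\<And>x y. x * y \<in> M \<Longrightarrow> x \<in> M \<or> y \<in> M"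
      "of_nat p \<in> M" "monom 1 n - 1 \<in> M" "\<And>i. 0 < i \<Longrightarrow> i < n \<Longrightarrow> monom 1 i - 1 \<notin> M"
    using exists_prime_ideal_primitive_root[OF p n(1)] by metis
  interpret residue_domain M p by unfold_locales (use M p in auto)
  write cong (infix "\<approx>" 50)
  have pow: "x ^ (p ^ N) \<approx> x" for x
  proof (induction x)
    case 0
    show ?case using n(2) by (simp flip: n(2))
  next
    case (pCons a x)
    have X: "monom 1 1 ^ (p ^ N) \<approx> monom 1 (1::nat)"
    proof -
      have "monom (1::int) 1 ^ (p ^ N) = monom 1 n * monom 1 1"
        by (simp add: monom_power mult_monom flip: n(2))
      also have "\<dots> \<approx> 1 * monom 1 1" using M(5) by (intro cong_mult) (auto simp: cong_def)
      finally show ?thesis by simp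
    qed
    have a: "[:a:] ^ (p ^ N) \<approx> [:a:]"
    proof (cases "a \<ge> 0")
      case True
      hence "[:a:] = of_nat (nat a)" by (simp add: of_nat_poly)
      thus ?thesis using of_nat_power_p by metis
    next
      case False
      hence "[:a:] = - of_nat (nat (- a))" by (simp add: of_nat_poly)
      thus ?thesis using cong_trans[OF frobenius_minus cong_minus[OF of_nat_power_p]] by metis
    qed
    have e: "pCons a x = [:a:] + monom 1 1 * x" by (simp add: monom_altdef)
    have "pCons a x ^ (p ^ N) \<approx> [:a:] ^ (p ^ N) + (monom 1 1 * x) ^ (p ^ N)"
      unfolding e by (rule frobenius_add)
    also have "\<dots> \<approx> [:a:] + monom 1 1 * x"
      unfolding power_mult_distrib by (intro cong_add cong_mult a X pCons.IH)
    finally show ?case using e by simp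
  qed
  have "card K = Suc n"
  proof (rule card_K_primitive_root[OF _ n(1), where z = "monom 1 1"])
    show "x ^ Suc n \<approx> x" for x using pow[of x] by (simp only: n(2))
  qed (use M in \<open>auto simp: monom_power cong_def\<close>)
  hence "card K = p ^ N" using n(2) by simp
  with pow show ?thesis using that residue_domain_axioms by blast
qed

section \<open>Norm and trace of a quadratic extension\<close>

text \<open>The residue field $K$ has order $q^2$ with $q = p^m$; the elements fixed by $x \mapsto x^q$
  form the subfield $F$ of order $q$.\<close>

locale quadratic_extension = residue_domain M p
  for M :: "'a::comm_ring_1 set" and p :: nat +
  fixes m :: nat
  assumes m_pos: "m > 0" and pow_card: "x ^ (p ^ (2 * m)) \<approx> x" and card_K: "card K = p ^ (2 * m)"
begin

definition q where "q = p ^ m"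

lemma p_gt_1: "p > 1" using prime_p by (rule prime_gt_1_nat)

lemma q_gt_1: "q > 1" unfolding q_def using p_gt_1 m_pos by (intro one_less_power)

lemma card_K_q: "card K = q * q" by (simp add: card_K q_def mult_2 power_add)

lemma finite_K [simp, intro]: "finite K"
  using card_K_q q_gt_1 by (intro card_ge_0_finite) simp

lemma pow_q_q: "(x ^ q) ^ q \<approx> x"
  using pow_card[of x] by (simp add: q_def mult_2 power_add flip: power_mult)

lemma frob_add: "(x + y) ^ q \<approx> x ^ q + y ^ q" unfolding q_def by (rule frobenius_add)
lemma frob_diff: "(x - y) ^ q \<approx> x ^ q - y ^ q" unfolding q_def by (rule frobenius_diff)
lemma frob_minus: "(- x) ^ q \<approx> - (x ^ q)" unfolding q_def by (rule frobenius_minus)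

definition fixed :: "'a \<Rightarrow> bool" where "fixed x \<longleftrightarrow> x ^ q \<approx> x"

lemma fixed_cong: "x \<approx> y \<Longrightarrow> fixed x \<longleftrightarrow> fixed y"
  unfolding fixed_def by (intro cong_iff cong_power)

lemma fixed_of_nat [simp, intro]: "fixed (of_nat c)"
  unfolding fixed_def q_def by (rule of_nat_power_p)

lemma fixed_0 [simp, intro]: "fixed 0" using fixed_of_nat[of 0] by simp

lemma fixed_add: "fixed x \<Longrightarrow> fixed y \<Longrightarrow> fixed (x + y)"
  unfolding fixed_def by (blast intro: cong_trans[OF frob_add cong_add])
lemma fixed_diff: "fixed x \<Longrightarrow> fixed y \<Longrightarrow> fixed (x - y)"
  unfolding fixed_def by (blast intro: cong_trans[OF frob_diff cong_diff])
lemma fixed_minus: "fixed x \<Longrightarrow> fixed (- x)"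
  unfolding fixed_def by (blast intro: cong_trans[OF frob_minus cong_minus])
lemma fixed_mult: "fixed x \<Longrightarrow> fixed y \<Longrightarrow> fixed (x * y)"
  unfolding fixed_def power_mult_distrib by (rule cong_mult)
lemmas fixed_intros = fixed_add fixed_diff fixed_minus fixed_mult

definition F where "F = {x \<in> K. fixed x}"

lemma finite_F [simp, intro]: "finite F" by (simp add: F_def)

lemma F_subset_K: "F \<subseteq> K" by (auto simp: F_def)

lemma rep_in_F [simp]: "rep x \<in> F \<longleftrightarrow> fixed x"
  using fixed_cong[OF rep_cong] by (simp add: F_def)

lemma card_F_le: "card F \<le> q"
proof -
  let ?g = "- monom 1 1 :: 'a poly"
  have d: "degree ?g < q" using q_gt_1 by (simp add: degree_monom_eq)
  have "card F \<le> degree (monom 1 q + ?g)"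
    using monic_monom_add[OF d]
    by (intro card_roots_in_K_le) (auto simp: F_def fixed_def poly_monom cong_diff_0)
  thus ?thesis using monic_monom_add[OF d] by simp
qed

definition norm :: "'a \<Rightarrow> 'a" where "norm w = w * w ^ q"

lemma norm_cong: "x \<approx> y \<Longrightarrow> norm x \<approx> norm y"
  unfolding norm_def by (intro cong_mult cong_power)

lemma norm_cong_0_iff [simp]: "norm w \<approx> 0 \<longleftrightarrow> w \<approx> 0"
  using q_gt_1 by (simp add: norm_def mult_cong_0_iff power_cong_0_iff)

lemma norm_minus: "norm (- w) \<approx> norm w"
proof -
  have "norm (- w) \<approx> - w * - (w ^ q)" unfolding norm_def by (intro cong_mult frob_minus) auto
  thus ?thesis by (simp add: norm_def)
qed

lemma fixed_norm [simp, intro]: "fixed (norm w)"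
proof -
  have "norm w ^ q = w ^ q * (w ^ q) ^ q" by (simp add: norm_def power_mult_distrib)
  also have "\<dots> \<approx> w ^ q * w" by (intro cong_mult pow_q_q) auto
  finally show ?thesis by (simp add: fixed_def norm_def mult.commute)
qed

lemma card_norm_fibre_0: "card {w \<in> K. norm w \<approx> 0} = 1"
proof -
  have "{w \<in> K. norm w \<approx> 0} = {rep 0}" by (auto intro: K_eqI)
  thus ?thesis by simp
qed

text \<open>The $q^2 - 1$ nonzero elements of $K$ are mapped to at most $q - 1$ nonzero elements of $F$, and a
  fibre consists of roots of $X^{q+1} - y$, so it has at most $q + 1$ elements.\<close>

lemma norm_fibres:
  shows "card F = q" and "fixed s \<Longrightarrow> \<not> s \<approx> 0 \<Longrightarrow> card {w \<in> K. norm w \<approx> s} = Suc q"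
proof -
  let ?A = "K - {rep 0}" and ?B = "F - {rep 0}" and ?f = "\<lambda>w. rep (norm w)"
  have r0: "rep 0 \<in> K" "rep 0 \<in> F" by auto
  have nz: "x = rep 0 \<longleftrightarrow> x \<approx> 0" if "x \<in> K" for x
    using that rep_K rep_eq_iff by metis
  have f1: "finite ?A" and f2: "finite ?B" by auto
  have f3: "?f ` ?A \<subseteq> ?B" by (auto simp: nz rep_eq_iff)
  have f4: "card ?A = (q - 1) * Suc q"
    using r0 card_K_q q_gt_1 by (simp add: card_Diff_singleton algebra_simps diff_mult_distrib)
  have f5: "card ?B \<le> q - 1" using r0 card_F_le by (simp add: card_Diff_singleton)
  have f6: "card {w \<in> ?A. ?f w = y} \<le> Suc q" if y: "y \<in> ?B" for y
  proof -
    have d: "degree [:- y:] < Suc q" using q_gt_1 by simp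
    have "card {w \<in> ?A. ?f w = y} \<le> degree (monom 1 (Suc q) + [:- y:])"
    proof (rule card_roots_in_K_le[OF finite_K monic_monom_add(2)[OF d]])
      fix x assume "x \<in> {w \<in> ?A. ?f w = y}"
      hence "norm x \<approx> y" by (metis (mono_tags, lifting) cong_sym mem_Collect_eq rep_cong)
      thus "poly (monom 1 (Suc q) + [:- y:]) x \<approx> 0" by (simp add: poly_monom norm_def cong_diff_0)
    qed auto
    thus ?thesis using monic_monom_add(1)[OF d] by simp
  qed
  note * = fibre_cards_exact[OF f1 f2 f3 f4 f5 zero_less_Suc f6]
  show "card F = q" using *(1) r0 q_gt_1 finite_F by (simp add: card_Diff_singleton)
  show "card {w \<in> K. norm w \<approx> s} = Suc q" if s: "fixed s" "\<not> s \<approx> 0"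
  proof -
    have "\<not> w \<approx> 0" if "norm w \<approx> s" for w
    proof
      assume "w \<approx> 0"
      hence "norm w \<approx> 0" by simp
      with that have "s \<approx> 0" by (rule cong_trans[OF cong_sym])
      thus False using s(2) by simp
    qed
    hence "{w \<in> K. norm w \<approx> s} = {w \<in> ?A. ?f w = rep s}"
      by (auto simp: nz rep_eq_iff)
    also have "card \<dots> = Suc q" using s by (intro *(2)) (auto simp: rep_eq_iff)
    finally show ?thesis .
  qed
qed

lemmas card_F = norm_fibres(1)

text \<open>The same argument for $u \mapsto u + u^q$, where a fibre consists of roots of
  $X^q + X - y$.\<close>

lemma card_trace_fibre:
  assumes "fixed s"
  shows "card {u \<in> K. u + u ^ q \<approx> s} = q"
proof -
  let ?f = "\<lambda>u. rep (u + u ^ q)"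
  have f3: "?f ` K \<subseteq> F"
  proof -
    have "fixed (u + u ^ q)" for u
    proof -
      have "(u + u ^ q) ^ q \<approx> u ^ q + u"
        by (rule cong_trans[OF frob_add]) (intro cong_add pow_q_q cong_refl)
      thus ?thesis by (simp add: fixed_def add.commute)
    qed
    thus ?thesis by auto
  qed
  have f5: "card F \<le> q" "q > 0" using card_F q_gt_1 by auto
  have f6: "card {u \<in> K. ?f u = y} \<le> q" if y: "y \<in> F" for y
  proof -
    let ?g = "[:- y, 1:]"
    have d: "degree ?g < q" using q_gt_1 by simp
    have "card {u \<in> K. ?f u = y} \<le> degree (monom 1 q + ?g)"
    proof (rule card_roots_in_K_le[OF finite_K monic_monom_add(2)[OF d]])
      fix x assume "x \<in> {u \<in> K. ?f u = y}"
      hence "x + x ^ q \<approx> y" by (metis (mono_tags, lifting) cong_sym mem_Collect_eq rep_cong)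
      hence "x + x ^ q - y \<approx> 0" by (simp add: cong_diff_0)
      thus "poly (monom 1 q + ?g) x \<approx> 0" by (simp add: poly_monom algebra_simps)
    qed auto
    thus ?thesis using monic_monom_add(1)[OF d] by simp
  qed
  note * = fibre_cards_exact(2)[OF finite_K finite_F f3 card_K_q f5 f6]
  have "{u \<in> K. u + u ^ q \<approx> s} = {u \<in> K. ?f u = rep s}" by (simp add: rep_eq_iff)
  thus ?thesis using *[of "rep s"] assms by simp
qed

lemma card_affine_substitution:
  assumes u: "\<not> u \<approx> 0" and P: "\<And>x y. x \<approx> y \<Longrightarrow> P x \<longleftrightarrow> P y"
  shows "card {w \<in> K. P (u * w + v)} = card {w \<in> K. P w}"
proof -
  let ?f = "\<lambda>w. rep (u * w + v)"
  have inj: "inj_on ?f K"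
  proof (rule inj_onI)
    fix x y assume xy: "x \<in> K" "y \<in> K" "?f x = ?f y"
    hence "u * x + v - v \<approx> u * y + v - v" by (intro cong_diff) (auto simp: rep_eq_iff)
    hence "x \<approx> y" using mult_cong_cancel[OF u] by simp
    thus "x = y" using xy K_eqI by blast
  qed
  have onto: "?f ` K = K" using inj by (intro endo_inj_surj) auto
  have P': "P (u * w + v) \<longleftrightarrow> P (?f w)" for w using P[OF rep_cong[of "u * w + v"]] by simp
  have "?f ` {w \<in> K. P (u * w + v)} = {w \<in> K. P w}"
    unfolding P' using onto by auto
  moreover have "inj_on ?f {w \<in> K. P (u * w + v)}" using inj by (rule inj_on_subset) auto
  hence "card (?f ` {w \<in> K. P (u * w + v)}) = card {w \<in> K. P (u * w + v)}" by (rule card_image)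
  ultimately show ?thesis by simp
qed

lemma norm_add: "norm (x + y) \<approx> (x + y) * (x ^ q + y ^ q)"
  unfolding norm_def by (intro cong_mult frob_add cong_refl)

text \<open>Complete the square. With $e = d - c$ and $u = ew + da$, the equation multiplied by $e$ becomes
  $N(u) \equiv be + cd\,N(a)$, because $c$ and $d$ are fixed by $x \mapsto x^q$; it remains to
  read off the size of a fibre of the norm.\<close>

lemma card_norm_equation_neq:
  assumes fx: "fixed b" "fixed c" "fixed d" and cd: "\<not> c \<approx> d"
  shows "card {w \<in> K. d * norm (w + a) \<approx> b + c * norm w} =
    (if b * (d - c) + c * d * norm a \<approx> 0 then 1 else Suc q)"
proof -
  \<comment> \<open>$e$ is not congruent to zero, so multiplying the equation by it loses nothing\<close>
  define e where "e = d - c"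
  define s where "s = b * (d - c) + c * d * norm a"
  have e0: "\<not> e \<approx> 0" using cd by (auto simp: e_def cong_diff_0 dest: cong_sym)
  have fe: "fixed e" using fx by (auto simp: e_def intro: fixed_intros)
  have "d * norm (w + a) \<approx> b + c * norm w \<longleftrightarrow> norm (e * w + d * a) \<approx> s" for w
  proof -
    have "norm (e * w + d * a) \<approx> (e * w + d * a) * ((e * w) ^ q + (d * a) ^ q)" by (rule norm_add)
    also have "\<dots> \<approx> (e * w + d * a) * (e * w ^ q + d * a ^ q)"
      unfolding power_mult_distrib
      using fe fx by (intro cong_mult cong_add cong_refl) (auto simp: fixed_def)
    finally have "norm (e * w + d * a) - s \<approx> (e * w + d * a) * (e * w ^ q + d * a ^ q) - s"
      by (intro cong_diff cong_refl)
    also have "\<dots> = e * (d * ((w + a) * (w ^ q + a ^ q)) - (b + c * norm w))"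
      by (simp add: e_def s_def norm_def algebra_simps)
    also have "\<dots> \<approx> e * (d * norm (w + a) - (b + c * norm w))"
      by (intro cong_mult cong_diff cong_refl cong_sym[OF norm_add])
    finally have *: "norm (e * w + d * a) - s \<approx> e * (d * norm (w + a) - (b + c * norm w))" .
    have "norm (e * w + d * a) \<approx> s \<longleftrightarrow> norm (e * w + d * a) - s \<approx> 0" by (simp only: cong_diff_0)
    also have "\<dots> \<longleftrightarrow> e * (d * norm (w + a) - (b + c * norm w)) \<approx> 0"
      using * by (intro cong_iff) auto
    also have "\<dots> \<longleftrightarrow> d * norm (w + a) \<approx> b + c * norm w"
      using e0 by (simp add: mult_cong_0_iff cong_diff_0)
    finally show ?thesis by simp
  qed
  hence "card {w \<in> K. d * norm (w + a) \<approx> b + c * norm w} = card {w \<in> K. norm (e * w + d * a) \<approx> s}"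
    by simp
  also have "\<dots> = card {w \<in> K. norm w \<approx> s}"
    using e0 by (rule card_affine_substitution) (meson cong_iff cong_refl norm_cong)
  also have "\<dots> = (if s \<approx> 0 then 1 else Suc q)"
  proof (cases "s \<approx> 0")
    case True
    hence "{w \<in> K. norm w \<approx> s} = {w \<in> K. norm w \<approx> 0}" using cong_iff by blast
    thus ?thesis using True card_norm_fibre_0 by simp
  next
    case False
    have "fixed s" using fx by (auto simp: s_def intro!: fixed_intros)
    thus ?thesis using False norm_fibres(2) by simp
  qed
  finally show ?thesis by (simp add: s_def)
qed

text \<open>The quadratic terms cancel. What is left is a trace equation for $u = c\,a^q w$.\<close>

lemma card_norm_equation_eq:
  assumes fx: "fixed b" "fixed c" and c0: "\<not> c \<approx> 0" and a0: "\<not> a \<approx> 0"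
  shows "card {w \<in> K. c * norm (w + a) \<approx> b + c * norm w} = q"
proof -
  define s where "s = b - c * norm a"
  \<comment> \<open>chosen so that $u w + (u w)^q \equiv c (a^q w + a w^q)$, the mixed terms of $c N(w + a)$\<close>
  define u where "u = c * a ^ q"
  have u0: "\<not> u \<approx> 0" using c0 a0 q_gt_1 by (simp add: u_def mult_cong_0_iff power_cong_0_iff)
  have "c * norm (w + a) \<approx> b + c * norm w \<longleftrightarrow> (u * w + 0) + (u * w + 0) ^ q \<approx> s" for w
  proof -
    have "(u * w + 0) + (u * w + 0) ^ q = c * a ^ q * w + c ^ q * (a ^ q) ^ q * w ^ q"
      by (simp add: u_def power_mult_distrib)
    also have "\<dots> \<approx> c * a ^ q * w + c * a * w ^ q"
      using fx pow_q_q by (intro cong_add cong_mult cong_refl) (auto simp: fixed_def)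
    finally have "(u * w + 0) + (u * w + 0) ^ q - s \<approx> c * a ^ q * w + c * a * w ^ q - s"
      by (intro cong_diff cong_refl)
    also have "\<dots> = c * ((w + a) * (w ^ q + a ^ q)) - (b + c * norm w)"
      by (simp add: s_def norm_def algebra_simps)
    also have "\<dots> \<approx> c * norm (w + a) - (b + c * norm w)"
      by (intro cong_mult cong_diff cong_refl cong_sym[OF norm_add])
    finally have "(u * w + 0) + (u * w + 0) ^ q - s \<approx> 0 \<longleftrightarrow> c * norm (w + a) - (b + c * norm w) \<approx> 0"
      by (intro cong_iff) auto
    thus ?thesis by (simp only: cong_diff_0)
  qed
  hence "card {w \<in> K. c * norm (w + a) \<approx> b + c * norm w} = card {w \<in> K. (u * w + 0) + (u * w + 0) ^ q \<approx> s}"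
    by simp
  also have "\<dots> = card {w \<in> K. w + w ^ q \<approx> s}"
    by (rule card_affine_substitution[OF u0, where P = "\<lambda>z. z + z ^ q \<approx> s"])
       (meson cong_add cong_iff cong_power cong_refl)
  also have "\<dots> = q" using fx by (intro card_trace_fibre) (auto simp: s_def intro!: fixed_intros)
  finally show ?thesis .
qed

end

section \<open>Solutions of norm equations over the prime field\<close>

lemma card_linear_congruence:
  fixes p :: nat and k r :: int
  assumes p: "prime p" and k: "\<not> int p dvd k" and r: "\<not> int p dvd r"
  shows "card {d \<in> {1..<p}. int p dvd int d * k - r} = 1"
proof -
  have pi: "prime (int p)" using p by simp
  have p0: "int p > 0" using p by (simp add: prime_gt_0_nat)
  have "coprime k (int p)" using k pi by (metis coprime_commute prime_imp_coprime)
  then obtain u v where uv: "u * k + v * int p = 1" by (metis bezout_int coprime_imp_gcd_eq_1)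
  define d0 where "d0 = nat ((u * r) mod int p)"
  have d0: "int d0 = (u * r) mod int p" using p0 by (simp add: d0_def)
  have "int p dvd int d0 - u * r" unfolding d0 by (simp add: mod_eq_dvd_iff flip: mod_eq_dvd_iff)
  from dvd_diff[OF dvd_mult2[OF this, of k] dvd_triv_right[of "int p" "v * r"]]
  have "int p dvd (int d0 - u * r) * k - v * r * int p" .
  also have "(int d0 - u * r) * k - v * r * int p = int d0 * k - (u * k + v * int p) * r"
    by (simp add: algebra_simps)
  finally have sol: "int p dvd int d0 * k - r" by (simp add: uv)
  have "d0 < p" using p0 d0 by (metis of_nat_less_iff pos_mod_bound)
  moreover have "d0 \<noteq> 0" using sol r by (intro notI) simp
  moreover have "d = d0" if d: "d \<in> {1..<p}" "int p dvd int d * k - r" for d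
  proof -
    have "int p dvd (int d * k - r) - (int d0 * k - r)" by (rule dvd_diff[OF d(2) sol])
    also have "(int d * k - r) - (int d0 * k - r) = (int d - int d0) * k" by (simp add: algebra_simps)
    finally have "int p dvd int d - int d0" using k pi by (simp add: prime_dvd_mult_iff)
    hence "int d mod int p = int d0 mod int p" by (simp add: mod_eq_dvd_iff)
    thus ?thesis using d \<open>d0 < p\<close> by simp
  qed
  ultimately have "{d \<in> {1..<p}. int p dvd int d * k - r} = {d0}" using sol by auto
  thus ?thesis by simp
qed

text \<open>The congruence says $1/c - 1/d \equiv -1/s$ modulo $p$, so that $c$ determines $d$, and the only value of
  $c$ that has no partner is $p - s$.\<close>

lemma card_reciprocal_pairs:
  fixes p s :: nat
  assumes p: "prime p" and s: "s \<in> {1..<p}"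
  shows "card {(c, d) \<in> {1..<p} \<times> {1..<p}. int p dvd int s * (int d - int c) + int c * int d} = p - 2"
proof -
  let ?Z = "\<lambda>c. {d \<in> {1..<p}. int p dvd int d * (int s + int c) - int s * int c}"
  have pi: "prime (int p)" using p by simp
  have small: "\<not> int p dvd int c" if "c \<in> {1..<p}" for c using that by (auto dest: dvd_imp_le)
  have Z: "card (?Z c) = (if c = p - s then 0 else 1)" if c: "c \<in> {1..<p}" for c
  proof -
    have sc: "\<not> int p dvd int s * int c" using pi small[OF s] small[OF c] by (simp only: prime_dvd_mult_iff) simp
    show ?thesis
    proof (cases "c = p - s")
      case True
      hence "int s + int c = int p" using s by auto
      hence "?Z c = {}" using sc by (auto simp: dvd_diff_right_iff)
      hence "card (?Z c) = 0" by (simp only: card.empty)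
      thus ?thesis unfolding if_P[OF True] .
    next
      case False
      have "\<not> int p dvd int s + int c"
      proof
        assume "int p dvd int s + int c"
        hence "p dvd s + c" by (simp flip: of_nat_add)
        then obtain r where r: "s + c = p * r" by auto
        have "r \<noteq> 0" using r s by (intro notI) simp
        moreover have "p * r < p * 2" unfolding r[symmetric] using s c by auto
        hence "r < 2" by simp
        ultimately have "r = 1" by simp
        thus False using r False s by auto
      qed
      thus ?thesis using card_linear_congruence[OF p _ sc, of "int s + int c"] False by simp
    qed
  qed
  have "{(c, d) \<in> {1..<p} \<times> {1..<p}. int p dvd int s * (int d - int c) + int c * int d} = (SIGMA c:{1..<p}. ?Z c)"
    by (auto simp: algebra_simps)
  also have "card \<dots> = (\<Sum>c\<in>{1..<p}. if c = p - s then 0 else 1)"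
    using Z by (subst card_SigmaI) (auto intro!: sum.cong)
  also have "\<dots> = (\<Sum>c\<in>{1..<p} - {p - s}. 1)"
    by (intro sum.mono_neutral_cong_right) auto
  also have "\<dots> = p - 2"
  proof -
    have "p - s \<in> {1..<p}" using s by auto
    thus ?thesis by (simp add: card_Diff_singleton)
  qed
  finally show ?thesis .
qed

context quadratic_extension
begin

definition scalars :: "nat set" where "scalars = {1..<p}"

lemma finite_scalars [simp, intro]: "finite scalars" and card_scalars: "card scalars = p - 1"
  by (auto simp: scalars_def)

lemma scalar_nz: "c \<in> scalars \<Longrightarrow> \<not> of_nat c \<approx> 0"
  using of_nat_not_cong_0[of c] by (auto simp: scalars_def)

lemma scalar_inj: "c \<in> scalars \<Longrightarrow> d \<in> scalars \<Longrightarrow> of_nat c \<approx> of_nat d \<longleftrightarrow> c = d"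
  using of_nat_cong_imp_eq[of c d] by (auto simp: scalars_def)

lemma scalar_mult_inj:
  assumes "\<not> x \<approx> 0" "c \<in> scalars" "d \<in> scalars"
  shows "of_nat c * x \<approx> of_nat d * x \<longleftrightarrow> c = d"
  using mult_cong_cancel[OF assms(1), of "of_nat c" "of_nat d"] scalar_inj[OF assms(2,3)]
  by (simp add: mult.commute[of _ x])

text \<open>For $a \not\equiv 0$ there is at most one such scalar, the quotient $b / N(a)$ if that lies in
  $\mathbb{F}_p^*$. So the size of this set is $1$ or $0$, and it decides membership of $(a, b)$
  in the partial difference set.\<close>

definition quotients :: "'a \<Rightarrow> 'a \<Rightarrow> nat set" where
  "quotients a b = {s \<in> scalars. b \<approx> of_nat s * norm a}"

lemma quotients_eq_singleton: "\<not> a \<approx> 0 \<Longrightarrow> s \<in> quotients a b \<Longrightarrow> quotients a b = {s}"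
proof -
  assume a: "\<not> a \<approx> 0" "s \<in> quotients a b"
  have "r = s" if "r \<in> quotients a b" for r
  proof -
    have "b \<approx> of_nat r * norm a" "b \<approx> of_nat s * norm a" using that a by (auto simp: quotients_def)
    hence "of_nat r * norm a \<approx> of_nat s * norm a" by (rule cong_trans[OF cong_sym])
    thus ?thesis using that a scalar_mult_inj[of "norm a" r s] by (simp add: quotients_def)
  qed
  thus ?thesis using a(2) by blast
qed

text \<open>These are the pairs for which the completed square has right-hand side zero. They satisfy
  $b (1/c - 1/d) \equiv -N(a)$, hence exist only if $b / N(a)$ is a nonzero scalar $s$; then
  they are the pairs counted in \<open>card_reciprocal_pairs\<close>.\<close>

lemma card_degenerate_pairs:
  assumes a: "\<not> a \<approx> 0"
  shows "card {(c, d) \<in> scalars \<times> scalars. c \<noteq> d \<and>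
      b * (of_nat d - of_nat c) + of_nat c * of_nat d * norm a \<approx> 0} = (p - 2) * card (quotients a b)"
    (is "card ?Z = _")
proof -
  have pi: "prime (int p)" using prime_p by simp
  have small: "\<not> int p dvd int c" if "c \<in> scalars" for c
    using that by (auto simp: scalars_def dest: dvd_imp_le)
  have nprod: "\<not> int p dvd int c * int d" if "c \<in> scalars" "d \<in> scalars" for c d
    using small[OF that(1)] small[OF that(2)] pi by (simp only: prime_dvd_mult_iff) simp
  have key: "b * (of_nat d - of_nat c) + of_nat c * of_nat d * norm a
      \<approx> norm a * of_int (int s * (int d - int c) + int c * int d)" if s: "s \<in> quotients a b" for s c d
  proof -
    have "b * (of_nat d - of_nat c) + of_nat c * of_nat d * norm a
        \<approx> (of_nat s * norm a) * (of_nat d - of_nat c) + of_nat c * of_nat d * norm a"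
      using s by (intro cong_add cong_mult cong_refl) (auto simp: quotients_def)
    also have "\<dots> = norm a * of_int (int s * (int d - int c) + int c * int d)"
      by (simp add: algebra_simps)
    finally show ?thesis .
  qed
  show ?thesis
  proof (cases "quotients a b = {}")
    case True
    have "?Z = {}"
    proof (rule ccontr)
      assume "?Z \<noteq> {}"
      then obtain c d where cd: "c \<in> scalars" "d \<in> scalars" "c \<noteq> d"
        "b * (of_nat d - of_nat c) + of_nat c * of_nat d * norm a \<approx> 0" by auto
      have ncd: "\<not> of_nat d - of_nat c \<approx> 0" using cd scalar_inj[of d c] by (auto simp: cong_diff_0)
      have "\<not> int p dvd int c - int d" using ncd of_nat_cong_iff[of c d] cong_sym by (auto simp: cong_diff_0)
      \<comment> \<open>the scalar $s$ with $1/c - 1/d = -1/s$ would be the quotient of $b$ by $N(a)$\<close>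
      from card_linear_congruence[OF prime_p this nprod[OF cd(1,2)]]
      have "{s \<in> {1..<p}. int p dvd int s * (int c - int d) - int c * int d} \<noteq> {}"
        by (metis card.empty zero_neq_one)
      then obtain s where s: "s \<in> scalars" "int p dvd int s * (int c - int d) - int c * int d"
        by (auto simp: scalars_def)
      have s0: "of_int (int s * (int c - int d) - int c * int d) \<approx> 0" using s(2) by (simp only: of_int_cong_0_iff)
      have "(of_nat d - of_nat c) * (b - of_nat s * norm a) =
          (b * (of_nat d - of_nat c) + of_nat c * of_nat d * norm a) +
          of_int (int s * (int c - int d) - int c * int d) * norm a"
        by (simp add: algebra_simps)
      also have "\<dots> \<approx> 0 + 0" using cd(4) s0 by (intro cong_add mult_cong_0)
      finally have "b \<approx> of_nat s * norm a" using ncd by (simp add: mult_cong_0_iff cong_diff_0)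
      thus False using s(1) True by (auto simp: quotients_def)
    qed
    thus ?thesis using True by (simp only: card.empty mult_0_right)
  next
    case False
    then obtain s where s: "s \<in> quotients a b" by auto
    have "?Z = {(c, d) \<in> {1..<p} \<times> {1..<p}. int p dvd int s * (int d - int c) + int c * int d}"
    proof (rule Set.set_eqI)
      fix x :: "nat \<times> nat"
      obtain c d where x: "x = (c, d)" by (cases x)
      have "b * (of_nat d - of_nat c) + of_nat c * of_nat d * norm a \<approx> 0 \<longleftrightarrow>
          norm a * of_int (int s * (int d - int c) + int c * int d) \<approx> 0"
        using key[OF s] by (intro cong_iff) auto
      also have "\<dots> \<longleftrightarrow> int p dvd int s * (int d - int c) + int c * int d"
        using a unfolding mult_cong_0_iff of_int_cong_0_iff by simp
      finally have "b * (of_nat d - of_nat c) + of_nat c * of_nat d * norm a \<approx> 0 \<longleftrightarrow>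
        int p dvd int s * (int d - int c) + int c * int d" .
      thus "x \<in> ?Z \<longleftrightarrow> x \<in> {(c, d) \<in> {1..<p} \<times> {1..<p}. int p dvd int s * (int d - int c) + int c * int d}"
        using x nprod[of c c] by (auto simp: scalars_def)
    qed
    also have "card \<dots> = p - 2"
      using s by (intro card_reciprocal_pairs prime_p) (auto simp: quotients_def scalars_def)
    finally show ?thesis using quotients_eq_singleton[OF a s] by simp
  qed
qed

text \<open>A solution $((c, d), w)$ records that translating by $(a, b)$ moves the point $(w, c N(w))$ of
  the graph of $c N$ to a point of the graph of $d N$.\<close>

definition solutions :: "'a \<Rightarrow> 'a \<Rightarrow> ((nat \<times> nat) \<times> 'a) set" where
  "solutions a b = {((c, d), w). c \<in> scalars \<and> d \<in> scalars \<and> w \<in> K \<and>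
     of_nat d * norm (w + a) \<approx> b + of_nat c * norm w}"

lemma finite_solutions [simp, intro]: "finite (solutions a b)"
  by (rule finite_subset[of _ "(scalars \<times> scalars) \<times> K"]) (auto simp: solutions_def)

lemma card_solutions_eq_sum:
  "card (solutions a b) = (\<Sum>(c, d)\<in>scalars \<times> scalars.
     card {w \<in> K. of_nat d * norm (w + a) \<approx> b + of_nat c * norm w})"
proof -
  have "solutions a b = (SIGMA x:scalars \<times> scalars.
      {w \<in> K. of_nat (snd x) * norm (w + a) \<approx> b + of_nat (fst x) * norm w})"
    by (auto simp: solutions_def)
  also have "card \<dots> = (\<Sum>x\<in>scalars \<times> scalars.
      card {w \<in> K. of_nat (snd x) * norm (w + a) \<approx> b + of_nat (fst x) * norm w})"
    by (subst card_SigmaI) auto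
  finally show ?thesis by (simp add: case_prod_unfold)
qed

lemma sum_scalar_pairs:
  "(\<Sum>(c, d)\<in>scalars \<times> scalars. if c = d then x else y) = (p - 1) * x + (p - 1) * (p - 2) * (y::nat)"
proof -
  have "(\<Sum>d\<in>scalars. if c = d then x else y) = x + (p - 2) * y" if c: "c \<in> scalars" for c
  proof -
    have "(\<Sum>d\<in>scalars. if c = d then x else y) = x + (\<Sum>d\<in>scalars - {c}. if c = d then x else y)"
      using c by (subst sum.remove[of _ c]) auto
    also have "(\<Sum>d\<in>scalars - {c}. if c = d then x else y) = (\<Sum>d\<in>scalars - {c}. y)"
      by (intro sum.cong) auto
    finally show ?thesis using c by (simp add: card_Diff_singleton card_scalars diff_diff_eq numeral_2_eq_2)
  qed
  hence "(\<Sum>(c, d)\<in>scalars \<times> scalars. if c = d then x else y) = (\<Sum>c\<in>scalars. x + (p - 2) * y)"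
    by (simp add: sum.cartesian_product[symmetric])
  thus ?thesis by (simp add: card_scalars algebra_simps)
qed

text \<open>Sum the two counts over all pairs of scalars; each degenerate pair loses $q$ of its $q + 1$
  solutions.\<close>

lemma card_solutions:
  assumes a: "\<not> a \<approx> 0" and b: "fixed b"
  shows "card (solutions a b) + q * ((p - 2) * card (quotients a b)) =
    (p - 1) * q + (p - 1) * (p - 2) * Suc q"
proof -
  let ?n = "\<lambda>c d. card {w \<in> K. of_nat d * norm (w + a) \<approx> b + of_nat c * norm w}"
  let ?P = "\<lambda>c d. c \<noteq> d \<and> b * (of_nat d - of_nat c) + of_nat c * of_nat d * norm a \<approx> 0"
  have n: "?n c d + (if ?P c d then q else 0) = (if c = d then q else Suc q)"
    if cd: "c \<in> scalars" "d \<in> scalars" for c d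
  proof (cases "c = d")
    case True
    thus ?thesis using card_norm_equation_eq[OF b fixed_of_nat scalar_nz[OF cd(1)] a] by simp
  next
    case False
    hence "\<not> of_nat c \<approx> of_nat d" using scalar_inj[OF cd] by simp
    from card_norm_equation_neq[OF b fixed_of_nat fixed_of_nat this, of a] show ?thesis
      using False by simp
  qed
  have "(\<Sum>(c, d)\<in>scalars \<times> scalars. if ?P c d then q else 0) = (\<Sum>x\<in>{(c, d) \<in> scalars \<times> scalars. ?P c d}. q)"
    by (intro sum.mono_neutral_cong_right) (auto split: if_splits)
  also have "\<dots> = q * ((p - 2) * card (quotients a b))"
    using card_degenerate_pairs[OF a, of b] by simp
  finally have Z: "q * ((p - 2) * card (quotients a b)) = (\<Sum>(c, d)\<in>scalars \<times> scalars. if ?P c d then q else 0)" ..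
  have "card (solutions a b) + q * ((p - 2) * card (quotients a b)) =
      (\<Sum>(c, d)\<in>scalars \<times> scalars. ?n c d + (if ?P c d then q else 0))"
    unfolding Z card_solutions_eq_sum sum.distrib[symmetric] by (intro sum.cong) auto
  also have "\<dots> = (\<Sum>(c, d)\<in>scalars \<times> scalars. if c = d then q else Suc q)"
    using n by (intro sum.cong) auto
  finally show ?thesis by (simp only: sum_scalar_pairs)
qed

lemma card_solutions_0:
  assumes a: "a \<approx> 0" and b: "fixed b" "\<not> b \<approx> 0"
  shows "card (solutions a b) = (p - 1) * (p - 2) * Suc q"
proof -
  let ?n = "\<lambda>c d. card {w \<in> K. of_nat d * norm (w + a) \<approx> b + of_nat c * norm w}"
  have n: "?n c d = (if c = d then 0 else Suc q)" if cd: "c \<in> scalars" "d \<in> scalars" for c d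
  proof (cases "c = d")
    case True
    have "\<not> of_nat c * norm (w + a) \<approx> b + of_nat c * norm w" for w
    proof
      assume "of_nat c * norm (w + a) \<approx> b + of_nat c * norm w"
      moreover have "of_nat c * norm (w + a) \<approx> of_nat c * norm (w + 0)"
        using a by (intro cong_mult norm_cong cong_add cong_refl)
      ultimately have "b + of_nat c * norm w \<approx> of_nat c * norm (w + 0)" by (rule cong_trans[OF cong_sym])
      thus False using b(2) by (simp add: cong_def)
    qed
    thus ?thesis using True by simp
  next
    case False
    hence ncd: "\<not> of_nat c \<approx> of_nat d" using scalar_inj[OF cd] by simp
    have "\<not> b * (of_nat d - of_nat c) + of_nat c * of_nat d * norm a \<approx> 0"
    proof
      assume *: "b * (of_nat d - of_nat c) + of_nat c * of_nat d * norm a \<approx> 0"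
      have "b * (of_nat d - of_nat c) = (b * (of_nat d - of_nat c) + of_nat c * of_nat d * norm a) - of_nat c * of_nat d * norm a"
        by simp
      also have "\<dots> \<approx> 0 - 0" using * a by (intro cong_diff mult_cong_0) auto
      finally show False using b ncd cong_sym by (auto simp: mult_cong_0_iff cong_diff_0)
    qed
    thus ?thesis using card_norm_equation_neq[OF b(1) fixed_of_nat fixed_of_nat ncd, of a] False by simp
  qed
  have "card (solutions a b) = (\<Sum>(c, d)\<in>scalars \<times> scalars. if c = d then 0 else Suc q)"
    unfolding card_solutions_eq_sum using n by (intro sum.cong) auto
  thus ?thesis by (simp only: sum_scalar_pairs)
qed

end

section \<open>The Denniston set and its translates\<close>

context quadratic_extension
begin

definition axis :: "('a \<times> 'a) set" where
  "axis = {(w, l). w = rep 0 \<and> l \<in> F \<and> \<not> l \<approx> 0}"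

definition graphs :: "('a \<times> 'a) set" where
  "graphs = {(w, l). w \<in> K \<and> \<not> w \<approx> 0 \<and> l \<in> F \<and> (\<exists>c\<in>scalars. l \<approx> of_nat c * norm w)}"

text \<open>Apart from the origin this is the set of all $(w, l)$ with $l \not\equiv 0$ and
  $N(w) / l \in \mathbb{F}_p$. It is an analogue of Denniston's maximal arcs, whose cones consist of
  the $(w, l)$ with $N(w) / l^2$ in a fixed additive subgroup.\<close>

definition denniston :: "('a \<times> 'a) set" where "denniston = axis \<union> graphs"

definition shift :: "'a \<Rightarrow> 'a \<Rightarrow> 'a \<times> 'a \<Rightarrow> 'a \<times> 'a" where
  "shift a b x = (rep (a + fst x), rep (b + snd x))"

lemma axis_subset: "axis \<subseteq> K \<times> F" and graphs_subset: "graphs \<subseteq> K \<times> F"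
  by (auto simp: axis_def graphs_def)

lemma finite_axis [simp, intro]: "finite axis" and finite_graphs [simp, intro]: "finite graphs"
  by (simp_all add: finite_subset[OF axis_subset] finite_subset[OF graphs_subset])

lemma axis_graphs_disjoint: "axis \<inter> graphs = {}" by (auto simp: axis_def graphs_def)

lemma norm_rep_cong: "norm (rep x) \<approx> norm x" by (rule norm_cong) simp

lemma rep_pair_in_axis: "(rep x, rep y) \<in> axis \<longleftrightarrow> x \<approx> 0 \<and> fixed y \<and> \<not> y \<approx> 0"
  by (simp add: axis_def rep_eq_iff)

lemma rep_pair_in_graphs:
  "(rep x, rep y) \<in> graphs \<longleftrightarrow> \<not> x \<approx> 0 \<and> fixed y \<and> (\<exists>c\<in>scalars. y \<approx> of_nat c * norm x)"
proof -
  have "y \<approx> of_nat c * norm (rep x) \<longleftrightarrow> y \<approx> of_nat c * norm x" for c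
    by (intro cong_iff cong_mult norm_rep_cong cong_refl)
  thus ?thesis by (simp add: graphs_def)
qed

lemma graphsE:
  assumes "x \<in> graphs"
  obtains w c where "x = (w, rep (of_nat c * norm w))" "w \<in> K" "\<not> w \<approx> 0" "c \<in> scalars"
proof -
  obtain w l c where x: "x = (w, l)" "w \<in> K" "\<not> w \<approx> 0" "l \<in> F" "c \<in> scalars" "l \<approx> of_nat c * norm w"
    using assms by (auto simp: graphs_def)
  have "l = rep (of_nat c * norm w)"
    using x(4,6) F_subset_K rep_K rep_eq_iff by (metis subsetD)
  thus ?thesis using x that by blast
qed

lemma graph_point_in_graphs:
  assumes "w \<in> K" "\<not> w \<approx> 0" "c \<in> scalars"
  shows "(w, rep (of_nat c * norm w)) \<in> graphs"
  unfolding graphs_def using assms by (auto intro!: fixed_intros)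

lemma card_axis: "card axis = q - 1"
proof -
  have "axis = {rep 0} \<times> (F - {rep 0})"
    using F_subset_K rep_K rep_eq_iff by (auto simp: axis_def) (metis subsetD)
  thus ?thesis using card_F by (simp add: card_cartesian_product card_Diff_singleton)
qed

lemma card_graphs: "card graphs = (q * q - 1) * (p - 1)"
proof -
  let ?h = "\<lambda>(w, c). (w, rep (of_nat c * norm w))"
  have nz: "w \<in> K - {rep 0} \<longleftrightarrow> w \<in> K \<and> \<not> w \<approx> 0" for w
    using rep_K rep_eq_iff by (metis Diff_iff singleton_iff rep_in_K)
  have "graphs = ?h ` ((K - {rep 0}) \<times> scalars)"
  proof (rule equalityI; rule subsetI)
    fix x assume "x \<in> graphs"
    thus "x \<in> ?h ` ((K - {rep 0}) \<times> scalars)"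
    proof (rule graphsE)
      fix w c assume "x = (w, rep (of_nat c * norm w))" "w \<in> K" "\<not> w \<approx> 0" "c \<in> scalars"
      thus ?thesis using nz[of w] by (intro image_eqI[of _ _ "(w, c)"]) auto
    qed
  next
    fix x assume "x \<in> ?h ` ((K - {rep 0}) \<times> scalars)"
    then obtain w c where "x = (w, rep (of_nat c * norm w))" "w \<in> K - {rep 0}" "c \<in> scalars" by auto
    thus "x \<in> graphs" using graph_point_in_graphs nz[of w] by blast
  qed
  also have "card \<dots> = card ((K - {rep 0}) \<times> scalars)"
  proof (rule card_image, rule inj_onI)
    fix x y assume xy: "x \<in> (K - {rep 0}) \<times> scalars" "y \<in> (K - {rep 0}) \<times> scalars" "?h x = ?h y"
    obtain w c d where [simp]: "x = (w, c)" "y = (w, d)" using xy(3) by (cases x; cases y) auto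
    have "of_nat c * norm w \<approx> of_nat d * norm w" using xy(3) by (simp add: rep_eq_iff)
    hence "c = d" using xy nz[of w] scalar_mult_inj[of "norm w" c d] by simp
    thus "x = y" by simp
  qed
  also have "\<dots> = (q * q - 1) * (p - 1)"
    by (simp add: card_cartesian_product card_scalars card_Diff_singleton card_K_q)
  finally show ?thesis .
qed

lemma card_denniston: "card denniston = (q - 1) + (q * q - 1) * (p - 1)"
  unfolding denniston_def by (subst card_Un_disjoint) (auto simp: axis_graphs_disjoint card_axis card_graphs)

text \<open>A point of the union of the graphs determines $w$ and $c$, and its image determines $d$, provided that
  neither of the two points lies above $0$, where all the graphs meet.\<close>

lemma card_shift_graphs_graphs:
  assumes b: "fixed b"
  shows "card {x \<in> graphs. shift a b x \<in> graphs} =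
    card {x \<in> solutions a b. \<not> snd x \<approx> 0 \<and> \<not> snd x + a \<approx> 0}"
proof -
  let ?S = "{x \<in> solutions a b. \<not> snd x \<approx> 0 \<and> \<not> snd x + a \<approx> 0}"
  let ?h = "\<lambda>((c, d :: nat), w). (w, rep (of_nat c * norm w))"
  have mem: "shift a b (w, rep (of_nat c * norm w)) \<in> graphs \<longleftrightarrow>
      \<not> w + a \<approx> 0 \<and> (\<exists>d\<in>scalars. of_nat d * norm (w + a) \<approx> b + of_nat c * norm w)"
    for w c
  proof -
    have "b + rep (of_nat c * norm w) \<approx> b + of_nat c * norm w" by (intro cong_add cong_refl rep_cong)
    hence "shift a b (w, rep (of_nat c * norm w)) = (rep (w + a), rep (b + of_nat c * norm w))"
      by (simp add: shift_def rep_eq_iff add.commute)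
    moreover have "fixed (b + of_nat c * norm w)" using b by (intro fixed_intros) auto
    ultimately show ?thesis
      unfolding cong_sym_iff[of _ "b + of_nat c * norm w"] by (simp add: rep_pair_in_graphs)
  qed
  have img: "{x \<in> graphs. shift a b x \<in> graphs} = ?h ` ?S"
  proof (rule equalityI; rule subsetI)
    fix x assume x: "x \<in> {x \<in> graphs. shift a b x \<in> graphs}"
    hence "x \<in> graphs" by simp
    then obtain w c where w: "x = (w, rep (of_nat c * norm w))" "w \<in> K" "\<not> w \<approx> 0" "c \<in> scalars"
      by (rule graphsE)
    obtain d where "\<not> w + a \<approx> 0" "d \<in> scalars" "of_nat d * norm (w + a) \<approx> b + of_nat c * norm w"
      using x mem[of w c] w(1) by auto
    thus "x \<in> ?h ` ?S" using w by (intro image_eqI[of _ _ "((c, d), w)"]) (auto simp: solutions_def)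
  next
    fix x assume "x \<in> ?h ` ?S"
    then obtain c d w where w: "x = (w, rep (of_nat c * norm w))" "((c, d), w) \<in> ?S" by auto
    hence "c \<in> scalars" "d \<in> scalars" "w \<in> K" "\<not> w \<approx> 0" "\<not> w + a \<approx> 0"
      "of_nat d * norm (w + a) \<approx> b + of_nat c * norm w" by (auto simp: solutions_def)
    thus "x \<in> {x \<in> graphs. shift a b x \<in> graphs}"
      using w(1) mem[of w c] graph_point_in_graphs[of w c] by auto
  qed
  have "card (?h ` ?S) = card ?S"
  proof (rule card_image, rule inj_onI)
    fix x y assume xy: "x \<in> ?S" "y \<in> ?S" "?h x = ?h y"
    obtain c d w c' d' where e: "x = ((c, d), w)" "y = ((c', d'), w)"
      using xy(3) by (cases x; cases y) auto
    have s: "c \<in> scalars" "d \<in> scalars" "c' \<in> scalars" "d' \<in> scalars" "\<not> w \<approx> 0" "\<not> w + a \<approx> 0"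
      "of_nat d * norm (w + a) \<approx> b + of_nat c * norm w" "of_nat d' * norm (w + a) \<approx> b + of_nat c' * norm w"
      using xy(1,2) e by (auto simp: solutions_def)
    have "of_nat c * norm w \<approx> of_nat c' * norm w" using xy(3) e by (simp add: rep_eq_iff)
    hence cc: "c = c'" using s scalar_mult_inj[of "norm w" c c'] by simp
    have "of_nat d * norm (w + a) \<approx> of_nat d' * norm (w + a)"
      using cong_trans[OF s(7) cong_sym] s(8) cc by simp
    hence "d = d'" using s scalar_mult_inj[of "norm (w + a)" d d'] by simp
    thus "x = y" using cc e by simp
  qed
  thus ?thesis by (simp only: img)
qed

lemma of_nat_complement: "c \<in> scalars \<Longrightarrow> of_nat (p - c) \<approx> - of_nat c"
  using p_in by (simp add: scalars_def of_nat_diff cong_def)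

text \<open>The substitution $c \mapsto p - c$ exchanges $-b/N(a)$ with $b/N(a)$.\<close>

lemma card_negative_quotients: "card {c \<in> scalars. b + of_nat c * norm a \<approx> 0} = card (quotients a b)"
proof -
  have eq: "b + of_nat c * norm a \<approx> 0 \<longleftrightarrow> b \<approx> of_nat (p - c) * norm a" if "c \<in> scalars" for c
  proof -
    have "b + of_nat c * norm a \<approx> 0 \<longleftrightarrow> b \<approx> - of_nat c * norm a" by (simp add: cong_def)
    also have "\<dots> \<longleftrightarrow> b \<approx> of_nat (p - c) * norm a"
      using of_nat_complement[OF that] cong_sym by (intro cong_iff cong_mult) auto
    finally show ?thesis .
  qed
  have "bij_betw (\<lambda>c. p - c) {c \<in> scalars. b + of_nat c * norm a \<approx> 0} (quotients a b)"
  proof (rule bij_betw_byWitness[where f' = "\<lambda>c. p - c"])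
    show "(\<lambda>c. p - c) ` {c \<in> scalars. b + of_nat c * norm a \<approx> 0} \<subseteq> quotients a b"
    proof safe
      fix c assume c: "c \<in> scalars" "b + of_nat c * norm a \<approx> 0"
      thus "p - c \<in> quotients a b" using eq[OF c(1)] by (auto simp: quotients_def scalars_def)
    qed
    show "(\<lambda>c. p - c) ` quotients a b \<subseteq> {c \<in> scalars. b + of_nat c * norm a \<approx> 0}"
    proof safe
      fix c assume "c \<in> quotients a b"
      hence c: "c \<in> scalars" "b \<approx> of_nat c * norm a" "p - (p - c) = c"
        by (auto simp: quotients_def scalars_def)
      show c': "p - c \<in> scalars" using c by (auto simp: scalars_def)
      show "b + of_nat (p - c) * norm a \<approx> 0" using eq[OF c'] c by simp
    qed
  qed (auto simp: quotients_def scalars_def)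
  thus ?thesis by (rule bij_betw_same_card)
qed

text \<open>The next two lemmas count the spurious solutions in which one of the two points lies above $0$.\<close>

lemma card_solutions_at_0:
  "card {x \<in> solutions a b. snd x \<approx> 0} = (p - 1) * card (quotients a b)"
proof -
  have eq: "of_nat d * norm (rep 0 + a) \<approx> b + of_nat c * norm (rep 0) \<longleftrightarrow> b \<approx> of_nat d * norm a" for c d
  proof -
    have "of_nat d * norm (rep 0 + a) \<approx> of_nat d * norm (0 + a)"
      by (intro cong_mult norm_cong cong_add cong_refl) simp
    moreover have "b + of_nat c * norm (rep 0) \<approx> b + 0"
      by (intro cong_add cong_refl) (simp add: mult_cong_0)
    ultimately have "of_nat d * norm (rep 0 + a) \<approx> b + of_nat c * norm (rep 0) \<longleftrightarrow>
        of_nat d * norm (0 + a) \<approx> b + 0" by (rule cong_iff)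
    also have "\<dots> \<longleftrightarrow> b \<approx> of_nat d * norm a" using cong_sym_iff[of b] by simp
    finally show ?thesis .
  qed
  have "{x \<in> solutions a b. snd x \<approx> 0} = (scalars \<times> quotients a b) \<times> {rep 0}"
  proof (rule equalityI; rule subsetI)
    fix x assume x: "x \<in> {x \<in> solutions a b. snd x \<approx> 0}"
    obtain c d w where [simp]: "x = ((c, d), w)" by (cases x) auto
    have "w = rep 0" using x rep_K[of w] rep_eq_iff[of w 0] by (auto simp: solutions_def)
    thus "x \<in> (scalars \<times> quotients a b) \<times> {rep 0}"
      using x eq[of d c] by (simp add: solutions_def quotients_def)
  next
    fix x assume x: "x \<in> (scalars \<times> quotients a b) \<times> {rep 0}"
    obtain c d where [simp]: "x = ((c, d), rep 0)" using x by (cases x) auto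
    show "x \<in> {x \<in> solutions a b. snd x \<approx> 0}"
      using x eq[of d c] by (simp add: solutions_def quotients_def)
  qed
  thus ?thesis by (simp add: card_cartesian_product card_scalars)
qed

lemma card_solutions_at_minus:
  "card {x \<in> solutions a b. snd x + a \<approx> 0} = (p - 1) * card (quotients a b)"
proof -
  have eq: "of_nat d * norm (rep (- a) + a) \<approx> b + of_nat c * norm (rep (- a)) \<longleftrightarrow> b + of_nat c * norm a \<approx> 0" for c d
  proof -
    have "rep (- a) + a \<approx> - a + a" by (intro cong_add cong_refl rep_cong)
    hence "of_nat d * norm (rep (- a) + a) \<approx> 0" by (intro mult_cong_0) simp
    moreover have "b + of_nat c * norm (rep (- a)) \<approx> b + of_nat c * norm a"
      by (intro cong_add cong_mult cong_refl cong_trans[OF norm_rep_cong norm_minus])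
    ultimately have "of_nat d * norm (rep (- a) + a) \<approx> b + of_nat c * norm (rep (- a)) \<longleftrightarrow>
        0 \<approx> b + of_nat c * norm a" by (rule cong_iff)
    also have "\<dots> \<longleftrightarrow> b + of_nat c * norm a \<approx> 0" by (rule cong_sym_iff)
    finally show ?thesis .
  qed
  have "{x \<in> solutions a b. snd x + a \<approx> 0} =
      ({c \<in> scalars. b + of_nat c * norm a \<approx> 0} \<times> scalars) \<times> {rep (- a)}"
  proof (rule equalityI; rule subsetI)
    fix x assume x: "x \<in> {x \<in> solutions a b. snd x + a \<approx> 0}"
    obtain c d w where [simp]: "x = ((c, d), w)" by (cases x) auto
    have "w \<approx> - a" using x by (simp add: cong_def)
    hence "w = rep (- a)" using x rep_K[of w] rep_eq_iff[of w "- a"] by (auto simp: solutions_def)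
    thus "x \<in> ({c \<in> scalars. b + of_nat c * norm a \<approx> 0} \<times> scalars) \<times> {rep (- a)}"
      using x eq[of d c] by (simp add: solutions_def)
  next
    fix x assume x: "x \<in> ({c \<in> scalars. b + of_nat c * norm a \<approx> 0} \<times> scalars) \<times> {rep (- a)}"
    obtain c d where [simp]: "x = ((c, d), rep (- a))" using x by (cases x) auto
    have "rep (- a) + a \<approx> - a + a" by (intro cong_add cong_refl rep_cong)
    thus "x \<in> {x \<in> solutions a b. snd x + a \<approx> 0}"
      using x eq[of d c] by (simp add: solutions_def)
  qed
  thus ?thesis using card_negative_quotients[of b a]
    by (simp add: card_cartesian_product card_scalars mult.commute)
qed

lemma card_scalars_Diff: "A \<subseteq> scalars \<Longrightarrow> card (scalars - A) + card A = p - 1"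
  using card_mono[OF finite_scalars, of A] finite_subset[OF _ finite_scalars, of A]
  by (simp add: card_Diff_subset card_scalars)

text \<open>The image of $(0, l)$ is $(a, b + l)$, so each scalar $d$ contributes the point with
  $l \equiv d N(a) - b$, except when this $l$ vanishes.\<close>

lemma card_shift_axis_graphs:
  assumes a: "\<not> a \<approx> 0" and b: "fixed b"
  shows "card {x \<in> axis. shift a b x \<in> graphs} + card (quotients a b) = p - 1"
proof -
  let ?h = "\<lambda>d. (rep 0, rep (of_nat d * norm a - b))"
  have sh: "shift a b (rep 0, rep l) = (rep a, rep (b + l))" for l
  proof -
    have "a + rep 0 \<approx> a + 0" "b + rep l \<approx> b + l" by (intro cong_add cong_refl rep_cong)+
    thus ?thesis by (simp add: shift_def rep_eq_iff)
  qed
  have mem: "shift a b (rep 0, rep l) \<in> graphs \<longleftrightarrow> (\<exists>d\<in>scalars. l \<approx> of_nat d * norm a - b)" if "fixed l" for l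
    unfolding sh using that a b by (simp add: rep_pair_in_graphs fixed_add cong_def algebra_simps)
  have "{x \<in> axis. shift a b x \<in> graphs} = ?h ` (scalars - quotients a b)"
  proof (rule equalityI; rule subsetI)
    fix x assume x: "x \<in> {x \<in> axis. shift a b x \<in> graphs}"
    then obtain l where l: "x = (rep 0, rep l)" "fixed l" "\<not> l \<approx> 0"
      by (auto simp: axis_def F_def) (metis rep_K)
    then obtain d where d: "d \<in> scalars" "l \<approx> of_nat d * norm a - b" using x mem[OF l(2)] by auto
    have "d \<notin> quotients a b"
    proof
      assume "d \<in> quotients a b"
      hence "b \<approx> of_nat d * norm a" by (simp add: quotients_def)
      hence "of_nat d * norm a - b \<approx> 0" using cong_sym by (simp add: cong_diff_0)
      thus False using l(3) cong_trans[OF d(2)] by blast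
    qed
    thus "x \<in> ?h ` (scalars - quotients a b)" using l d by (auto simp: rep_eq_iff)
  next
    fix x assume "x \<in> ?h ` (scalars - quotients a b)"
    then obtain d where d: "x = ?h d" "d \<in> scalars" "\<not> b \<approx> of_nat d * norm a"
      by (auto simp: quotients_def)
    have f: "fixed (of_nat d * norm a - b)" using b by (auto intro!: fixed_intros)
    have "\<not> of_nat d * norm a - b \<approx> 0" using d(3) cong_sym by (auto simp: cong_diff_0)
    thus "x \<in> {x \<in> axis. shift a b x \<in> graphs}"
      using f d mem[OF f] by (auto simp: rep_pair_in_axis)
  qed
  also have "card \<dots> = card (scalars - quotients a b)"
  proof (rule card_image, rule inj_onI)
    fix c d assume cd: "c \<in> scalars - quotients a b" "d \<in> scalars - quotients a b" "?h c = ?h d"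
    hence "of_nat c * norm a \<approx> of_nat d * norm a" by (simp add: rep_eq_iff cong_def)
    thus "c = d" using cd a scalar_mult_inj[of "norm a" c d] by simp
  qed
  also have "\<dots> + card (quotients a b) = p - 1"
    by (intro card_scalars_Diff) (auto simp: quotients_def)
  finally show ?thesis .
qed

lemma card_shift_graphs_axis:
  assumes a: "\<not> a \<approx> 0" and b: "fixed b"
  shows "card {x \<in> graphs. shift a b x \<in> axis} + card (quotients a b) = p - 1"
proof -
  let ?N = "{c \<in> scalars. b + of_nat c * norm a \<approx> 0}"
  let ?h = "\<lambda>c. (rep (- a), rep (of_nat c * norm (rep (- a))))"
  have na: "norm (rep (- a)) \<approx> norm a" by (rule cong_trans[OF norm_rep_cong norm_minus])
  have sh: "shift a b (rep x, rep l) = (rep (a + x), rep (b + l))" for x l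
  proof -
    have "a + rep x \<approx> a + x" "b + rep l \<approx> b + l" by (intro cong_add cong_refl rep_cong)+
    thus ?thesis by (simp add: shift_def rep_eq_iff)
  qed
  have mem: "shift a b (rep x, rep (of_nat c * norm (rep x))) \<in> axis \<longleftrightarrow>
      x \<approx> - a \<and> \<not> b + of_nat c * norm (rep x) \<approx> 0" for x c
    unfolding sh using b by (simp add: rep_pair_in_axis fixed_add fixed_mult) (simp add: cong_def add.commute)
  have e: "b + of_nat c * norm (rep (- a)) \<approx> 0 \<longleftrightarrow> b + of_nat c * norm a \<approx> 0" for c
    using na by (intro cong_iff cong_add cong_mult) auto
  have nma: "\<not> - a \<approx> 0" using a cong_minus[of "- a" 0] by auto
  have "{x \<in> graphs. shift a b x \<in> axis} = ?h ` (scalars - ?N)"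
  proof (rule equalityI; rule subsetI)
    fix x assume x: "x \<in> {x \<in> graphs. shift a b x \<in> axis}"
    hence "x \<in> graphs" by simp
    then obtain w c where w: "x = (w, rep (of_nat c * norm w))" "w \<in> K" "\<not> w \<approx> 0" "c \<in> scalars"
      by (rule graphsE)
    have wa: "w = rep w" using w(2) rep_K by simp
    have m: "w \<approx> - a" "\<not> b + of_nat c * norm w \<approx> 0" using x mem[of w c] w(1) wa by auto
    hence ww: "w = rep (- a)" using wa rep_eq_iff by metis
    thus "x \<in> ?h ` (scalars - ?N)" using w(1,4) m(2) e[of c] by auto
  next
    fix x assume "x \<in> ?h ` (scalars - ?N)"
    then obtain c where c: "x = ?h c" "c \<in> scalars" "\<not> b + of_nat c * norm a \<approx> 0" by auto
    thus "x \<in> {x \<in> graphs. shift a b x \<in> axis}"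
      using mem[of "- a" c] e[of c] graph_point_in_graphs[of "rep (- a)" c] nma by simp
  qed
  also have "card \<dots> = card (scalars - ?N)"
  proof (rule card_image, rule inj_onI)
    fix c d assume cd: "c \<in> scalars - ?N" "d \<in> scalars - ?N" "?h c = ?h d"
    hence "of_nat c * norm (rep (- a)) \<approx> of_nat d * norm (rep (- a))" by (simp add: rep_eq_iff)
    thus "c = d" using cd nma scalar_mult_inj[of "norm (rep (- a))" c d] by simp
  qed
  also have "\<dots> + card ?N = p - 1"
    by (intro card_scalars_Diff) auto
  finally show ?thesis by (simp only: card_negative_quotients)
qed

lemma card_shift_split:
  "card {x \<in> denniston. shift a b x \<in> denniston} =
    card {x \<in> graphs. shift a b x \<in> graphs} + card {x \<in> axis. shift a b x \<in> axis} +
    card {x \<in> axis. shift a b x \<in> graphs} + card {x \<in> graphs. shift a b x \<in> axis}"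
proof -
  let ?A = "{x \<in> graphs. shift a b x \<in> graphs}" and ?B = "{x \<in> axis. shift a b x \<in> axis}"
    and ?C = "{x \<in> axis. shift a b x \<in> graphs}" and ?D = "{x \<in> graphs. shift a b x \<in> axis}"
  have union: "{x \<in> denniston. shift a b x \<in> denniston} = ((?A \<union> ?B) \<union> ?C) \<union> ?D"
    by (auto simp: denniston_def)
  have "card (((?A \<union> ?B) \<union> ?C) \<union> ?D) = card ?A + card ?B + card ?C + card ?D"
  proof -
    have d: False if "x \<in> axis" "x \<in> graphs" for x using axis_graphs_disjoint that by blast
    have disj: "((?A \<union> ?B) \<union> ?C) \<inter> ?D = {}" "(?A \<union> ?B) \<inter> ?C = {}" "?A \<inter> ?B = {}"
      by (auto dest: d)
    have fin: "finite ?A" "finite ?B" "finite ?C" "finite ?D" by simp_all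
    show ?thesis by (simp only: card_Un_disjoint[OF _ _ disj(1)] card_Un_disjoint[OF _ _ disj(2)]
        card_Un_disjoint[OF _ _ disj(3)] finite_Un fin simp_thms)
  qed
  thus ?thesis by (simp only: union)
qed

text \<open>Every solution counted in \<open>card_solutions\<close> that is not spurious is a common point; the axis adds
  $p - 1$ points in each direction, up to the correction by the quotient. Collecting the corrections,
  the number of common points drops by $2p + q(p-2)$ exactly when $b / N(a)$ is a nonzero
  scalar.\<close>

lemma card_translate_off_axis:
  assumes a: "\<not> a \<approx> 0" and b: "fixed b"
  shows "card {x \<in> denniston. shift a b x \<in> denniston} + (2 * p + q * (p - 2)) * card (quotients a b) =
    (p - 1) * q + (p - 1) * (p - 2) * Suc q + 2 * (p - 1)"
proof -
  let ?T = "{x \<in> solutions a b. snd x \<approx> 0}" and ?U = "{x \<in> solutions a b. snd x + a \<approx> 0}"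
    and ?S = "{x \<in> solutions a b. \<not> snd x \<approx> 0 \<and> \<not> snd x + a \<approx> 0}"
  have "?T \<inter> ?U = {}"
  proof -
    have False if "w \<approx> 0" "w + a \<approx> 0" for w
      using cong_diff[OF that(2,1)] a by simp
    thus ?thesis by blast
  qed
  moreover have "?T \<union> ?U \<union> ?S = solutions a b" by blast
  ultimately have "card (solutions a b) = card ?T + card ?U + card ?S"
    using card_Un_disjoint[of "?T \<union> ?U" ?S] card_Un_disjoint[of ?T ?U] by (simp add: disjoint_iff)
  hence 1: "card {x \<in> graphs. shift a b x \<in> graphs} + 2 * ((p - 1) * card (quotients a b)) = card (solutions a b)"
    using card_solutions_at_0 card_solutions_at_minus card_shift_graphs_graphs[OF b] by simp
  have 2: "card {x \<in> axis. shift a b x \<in> axis} = 0"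
  proof -
    have "shift a b x \<notin> axis" if "x \<in> axis" for x
    proof -
      have "a + fst x \<approx> a + 0" using that by (intro cong_add) (auto simp: axis_def)
      hence "\<not> a + fst x \<approx> 0" using a cong_iff[of "a + fst x" "a + 0" 0 0] by simp
      thus ?thesis by (simp add: shift_def rep_pair_in_axis)
    qed
    hence "{x \<in> axis. shift a b x \<in> axis} = {}" by blast
    thus ?thesis by (simp only: card.empty)
  qed
  have p: "p - 1 + 1 = p" using p_gt_1 by simp
  have "2 * (p * card (quotients a b)) = 2 * ((p - 1) * card (quotients a b)) + 2 * card (quotients a b)"
    by (subst (1) p[symmetric]) (simp only: algebra_simps)
  thus ?thesis
    unfolding card_shift_split 2
    using 1 card_shift_axis_graphs[OF a b] card_shift_graphs_axis[OF a b] card_solutions[OF a b]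
    by (simp add: add_mult_distrib mult.assoc)
qed

text \<open>For $a \equiv 0$ the graphs of $cN$ and of $cN + b$ are disjoint, and two different scalars give a
  norm equation with nonzero right-hand side. On the axis, the points other than $(0, 0)$ and
  $(0, -b)$ stay on it.\<close>

lemma card_translate_on_axis:
  assumes a: "a \<approx> 0" and b: "fixed b" "\<not> b \<approx> 0"
  shows "card {x \<in> denniston. shift a b x \<in> denniston} = (p - 1) * (p - 2) * Suc q + (q - 2)"
proof -
  have same: "w + a \<approx> 0 \<longleftrightarrow> w \<approx> 0" for w
    using cong_iff[OF cong_add[OF cong_refl a] cong_refl, of w 0] by simp
  have same': "a + w \<approx> 0 \<longleftrightarrow> w \<approx> 0" for w using same[of w] by (simp only: add.commute)
  have "\<not> w \<approx> 0" if "((c, d), w) \<in> solutions a b" for c d w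
  proof
    assume w: "w \<approx> 0"
    have "of_nat d * norm (w + a) - of_nat c * norm w \<approx> b"
      using that by (simp add: solutions_def cong_def algebra_simps)
    moreover have "of_nat d * norm (w + a) - of_nat c * norm w \<approx> 0 - 0"
      using w same by (intro cong_diff mult_cong_0) auto
    ultimately have "b \<approx> 0 - 0" by (rule cong_trans[OF cong_sym])
    thus False using b by simp
  qed
  hence "{x \<in> solutions a b. \<not> snd x \<approx> 0 \<and> \<not> snd x + a \<approx> 0} = solutions a b" using same by auto
  hence 1: "card {x \<in> graphs. shift a b x \<in> graphs} = (p - 1) * (p - 2) * Suc q"
    using card_shift_graphs_graphs[OF b(1)] card_solutions_0[OF a b] by simp
  have 2: "{x \<in> axis. shift a b x \<in> graphs} = {}"
    by (auto simp: shift_def rep_pair_in_graphs axis_def same')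
  have 3: "{x \<in> graphs. shift a b x \<in> axis} = {}"
    by (auto simp: shift_def rep_pair_in_axis graphs_def same')
  have z: "l = rep x \<longleftrightarrow> l \<approx> x" if "l \<in> F" for l x
    using that F_subset_K rep_K rep_eq_iff by (metis subsetD)
  have neg: "b + l \<approx> 0 \<longleftrightarrow> l \<approx> - b" for l by (simp add: cong_def add.commute)
  have "{x \<in> axis. shift a b x \<in> axis} = {rep 0} \<times> (F - {rep 0, rep (- b)})"
  proof (rule equalityI; rule subsetI)
    fix x assume x: "x \<in> {x \<in> axis. shift a b x \<in> axis}"
    obtain w l where [simp]: "x = (w, l)" by (cases x)
    have "w = rep 0" "l \<in> F" "\<not> l \<approx> 0" "\<not> b + l \<approx> 0"
      using x by (auto simp: axis_def shift_def)
    thus "x \<in> {rep 0} \<times> (F - {rep 0, rep (- b)})" using neg[of l] by auto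
  next
    fix x assume x: "x \<in> {rep 0} \<times> (F - {rep 0, rep (- b)})"
    obtain l where [simp]: "x = (rep 0, l)" using x by (cases x) auto
    have "l \<in> F" "\<not> l \<approx> 0" "\<not> b + l \<approx> 0" "fixed l" using x z[of l] neg[of l] by (auto simp: F_def)
    thus "x \<in> {x \<in> axis. shift a b x \<in> axis}"
      using b(1) by (simp add: shift_def rep_pair_in_axis same' fixed_add) (simp add: axis_def)
  qed
  moreover have "card (F - {rep 0, rep (- b)}) = q - 2"
  proof -
    have "rep 0 \<noteq> rep (- b)" using b(2) cong_minus[of 0 "- b"] cong_sym by (auto simp: rep_eq_iff)
    hence "card {rep 0, rep (- b)} = 2" by simp
    moreover have "{rep 0, rep (- b)} \<subseteq> F" using b(1) by (auto intro: fixed_intros)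
    ultimately show ?thesis using card_F by (simp add: card_Diff_subset)
  qed
  ultimately show ?thesis using 1 2 3 by (simp add: card_shift_split card_cartesian_product)
qed

end

section \<open>The additive partial difference set\<close>

context quadratic_extension
begin

definition additive_group :: "('a \<times> 'a) monoid" where
  "additive_group = \<lparr>carrier = K \<times> F, monoid.mult = (\<lambda>x y. shift (fst x) (snd x) y), one = (rep 0, rep 0)\<rparr>"

lemma rep_add_rep: "rep (rep x + y) = rep (x + y)" "rep (x + rep y) = rep (x + y)"
  unfolding rep_eq_iff by (intro cong_add rep_cong cong_refl)+

lemma fixed_if_F: "l \<in> F \<Longrightarrow> fixed l" by (simp add: F_def)

lemma F_in_K: "l \<in> F \<Longrightarrow> l \<in> K" by (simp add: F_def)

lemma additive_group_is_group: "group additive_group"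
proof (rule groupI)
  fix x assume "x \<in> carrier additive_group"
  then obtain w l where x: "x = (w, l)" "w \<in> K" "l \<in> F" by (auto simp: additive_group_def)
  thus "\<one>\<^bsub>additive_group\<^esub> \<otimes>\<^bsub>additive_group\<^esub> x = x"
    by (simp add: additive_group_def shift_def rep_add_rep rep_K F_in_K)
  show "\<exists>y\<in>carrier additive_group. y \<otimes>\<^bsub>additive_group\<^esub> x = \<one>\<^bsub>additive_group\<^esub>"
    using x by (intro bexI[of _ "(rep (- w), rep (- l))"])
      (auto simp: additive_group_def shift_def rep_add_rep fixed_if_F intro: fixed_minus)
qed (auto simp: additive_group_def shift_def rep_add_rep add.assoc fixed_if_F intro: fixed_add)

lemma denniston_parameters:
  defines "l \<equiv> p ^ m - p + (p ^ (m + 1) - p ^ m + p) * (p - 2)"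
    and "mu \<equiv> (p ^ (m + 1) - p ^ m + p) * (p - 1)"
  shows "(q - 1) + (q * q - 1) * (p - 1) = (p ^ m - 1) * ((p - 1) * (p ^ m + 1) + 1)"
    and "(p - 1) * (p - 2) * Suc q + (q - 2) = l"
    and "(p - 1) * q + (p - 1) * (p - 2) * Suc q + 2 * (p - 1) = mu"
    and "mu = l + (2 * p + q * (p - 2))"
proof -
  have "p ^ 1 \<le> p ^ m" using p_gt_1 m_pos by (intro power_increasing) auto
  hence pq: "p \<le> q" by (simp add: q_def)
  \<comment> \<open>writing $p = r + 2$ and $q = s + p$ removes all truncated subtractions\<close>
  define r where "r = p - 2"
  have p: "p = Suc (Suc r)" using p_gt_1 by (simp add: r_def)
  define s where "s = q - p"
  have q: "q = s + Suc (Suc r)" using pq p by (simp add: s_def)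
  have diff: "p ^ (m + 1) - p ^ m + p = Suc r * q + Suc (Suc r)"
    by (simp flip: q_def) (simp add: p algebra_simps)
  have l: "l = s + (Suc r * q + Suc (Suc r)) * r"
    unfolding l_def diff unfolding q_def[symmetric] by (simp add: s_def r_def)
  have mu: "mu = (Suc r * q + Suc (Suc r)) * Suc r"
    unfolding mu_def diff using p by simp
  show "(p - 1) * (p - 2) * Suc q + (q - 2) = l" unfolding l unfolding q unfolding p by (simp add: algebra_simps)
  show "(p - 1) * q + (p - 1) * (p - 2) * Suc q + 2 * (p - 1) = mu" unfolding mu unfolding p by (simp add: algebra_simps)
  show "mu = l + (2 * p + q * (p - 2))" unfolding mu l unfolding q unfolding p by (simp add: algebra_simps)
  show "(q - 1) + (q * q - 1) * (p - 1) = (p ^ m - 1) * ((p - 1) * (p ^ m + 1) + 1)"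
    unfolding q_def[symmetric] unfolding q unfolding p by (simp add: algebra_simps)
qed

lemma in_denniston_iff:
  assumes "a \<in> K" "b \<in> F"
  shows "(a, b) \<in> denniston \<longleftrightarrow> (if a \<approx> 0 then \<not> b \<approx> 0 else quotients a b \<noteq> {})"
proof -
  have "a = rep 0 \<longleftrightarrow> a \<approx> 0" using assms(1) rep_K[of a] rep_eq_iff[of a 0] by simp
  thus ?thesis using assms by (auto simp: denniston_def axis_def graphs_def quotients_def)
qed

theorem partial_difference_set_denniston:
  "partial_difference_set additive_group denniston (p ^ (3 * m))
     ((p ^ m - 1) * ((p - 1) * (p ^ m + 1) + 1))
     (p ^ m - p + (p ^ (m + 1) - p ^ m + p) * (p - 2))
     ((p ^ (m + 1) - p ^ m + p) * (p - 1))"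
proof -
  have sel: "carrier additive_group = K \<times> F" "\<one>\<^bsub>additive_group\<^esub> = (rep 0, rep 0)"
    by (simp_all add: additive_group_def)
  have mult: "(a, b) \<otimes>\<^bsub>additive_group\<^esub> x = shift a b x" for a b x by (simp add: additive_group_def)
  have off: "card {x \<in> denniston. shift a b x \<in> denniston} =
      (if quotients a b = {} then (p ^ (m + 1) - p ^ m + p) * (p - 1)
       else p ^ m - p + (p ^ (m + 1) - p ^ m + p) * (p - 2))"
    if "\<not> a \<approx> 0" "b \<in> F" for a b
  proof (cases "quotients a b = {}")
    case True
    thus ?thesis using card_translate_off_axis[OF that(1) fixed_if_F[OF that(2)]] denniston_parameters(3) by simp
  next
    case False
    then obtain s where "s \<in> quotients a b" by auto
    with that(1) have "quotients a b = {s}" by (rule quotients_eq_singleton)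
    hence "card (quotients a b) = 1" by simp
    thus ?thesis
      using False card_translate_off_axis[OF that(1) fixed_if_F[OF that(2)]]
        denniston_parameters(3,4) by simp
  qed
  show ?thesis
    unfolding partial_difference_set_iff_translates
  proof (intro conjI ballI)
    show "group additive_group" by (rule additive_group_is_group)
    show "finite (carrier additive_group)" by (simp add: sel)
    show "denniston \<subseteq> carrier additive_group" using axis_subset graphs_subset by (simp add: sel denniston_def)
    show "card (carrier additive_group) = p ^ (3 * m)"
      proof -
      have "3 * m = m + m + m" by simp
      thus ?thesis by (simp only: sel card_cartesian_product card_K_q card_F q_def power_add)
    qed
    show "card denniston = (p ^ m - 1) * ((p - 1) * (p ^ m + 1) + 1)"
      unfolding card_denniston by (rule denniston_parameters(1))
  next
    fix g assume "g \<in> denniston - {\<one>\<^bsub>additive_group\<^esub>}"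
    then obtain a b where g: "g = (a, b)" "a \<in> K" "b \<in> F" "(a, b) \<in> denniston"
      using axis_subset graphs_subset by (cases g) (auto simp: denniston_def)
    show "card {d \<in> denniston. g \<otimes>\<^bsub>additive_group\<^esub> d \<in> denniston} =
        p ^ m - p + (p ^ (m + 1) - p ^ m + p) * (p - 2)"
    proof (cases "a \<approx> 0")
      case True
      hence nb: "\<not> b \<approx> 0" using g in_denniston_iff by simp
      show ?thesis
        using card_translate_on_axis[OF True fixed_if_F[OF g(3)] nb] denniston_parameters(2) by (simp only: g(1) mult)
    next
      case False
      hence "quotients a b \<noteq> {}" using g in_denniston_iff by simp
      thus ?thesis using off[OF False g(3)] by (simp only: g(1) mult if_False simp_thms)
    qed
  next
    fix g assume "g \<in> carrier additive_group - (denniston \<union> {\<one>\<^bsub>additive_group\<^esub>})"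
    then obtain a b where g: "g = (a, b)" "a \<in> K" "b \<in> F" "(a, b) \<notin> denniston" "(a, b) \<noteq> (rep 0, rep 0)"
      by (cases g) (auto simp: sel)
    have "\<not> a \<approx> 0"
    proof
      assume a: "a \<approx> 0"
      hence "b \<approx> 0" using g in_denniston_iff by simp
      hence "(a, b) = (rep 0, rep 0)" using a g(2,3) rep_K[of a] rep_K[of b] rep_eq_iff F_in_K by metis
      thus False using g(5) by simp
    qed
    moreover from this have "quotients a b = {}" using g in_denniston_iff by simp
    ultimately show "card {d \<in> denniston. g \<otimes>\<^bsub>additive_group\<^esub> d \<in> denniston} = (p ^ (m + 1) - p ^ m + p) * (p - 1)"
      using off[of a b] g(3) by (simp only: g(1) mult if_True simp_thms)
  qed
qed

end

section \<open>Twisting the additive group by the Frobenius automorphism\<close>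

context quadratic_extension
begin

text \<open>The polynomial $X^p - X$ has at most $p$ roots and the residues $0, \ldots, p - 1$ are such
  roots.\<close>

lemma frobenius_fixed_is_nat:
  assumes "y ^ p \<approx> y"
  obtains n where "n < p" "of_nat n \<approx> y"
proof -
  let ?A = "(\<lambda>n. rep (of_nat n)) ` {..<p}" and ?B = "{x \<in> K. x ^ p \<approx> x}"
  have pow_rep: "rep x ^ p \<approx> rep x \<longleftrightarrow> x ^ p \<approx> x" for x by (intro cong_iff cong_power rep_cong)
  have "inj_on (\<lambda>n. rep (of_nat n :: 'a)) {..<p}"
    by (rule inj_onI) (simp add: rep_eq_iff of_nat_cong_imp_eq)
  hence A: "card ?A = p" by (simp add: card_image)
  have d: "degree (- monom 1 1 :: 'a poly) < p" using p_gt_1 by (simp add: degree_monom_eq)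
  have "card ?B \<le> degree (monom 1 p + - monom 1 1 :: 'a poly)"
    by (rule card_roots_in_K_le[OF finite_K monic_monom_add(2)[OF d]]) (auto simp: poly_monom cong_diff_0)
  hence B: "card ?B \<le> p" using monic_monom_add(1)[OF d] by simp
  have "?A \<subseteq> ?B" using of_nat_power_p[of _ 1] by (auto simp: pow_rep simp del: rep_cong_iff)
  hence "?A = ?B" using A B by (intro card_seteq) auto
  moreover have "rep y \<in> ?B" using assms by (simp only: mem_Collect_eq pow_rep rep_in_K simp_thms)
  ultimately obtain n where "n < p" "rep y = rep (of_nat n)" by blast
  thus ?thesis using that cong_sym by (simp add: rep_eq_iff)
qed

definition abs_trace :: "'a \<Rightarrow> 'a" where "abs_trace b = (\<Sum>i<m. b ^ (p ^ i))"

lemma abs_trace_cong: "x \<approx> y \<Longrightarrow> abs_trace x \<approx> abs_trace y"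
  unfolding abs_trace_def by (intro cong_sum cong_power)

lemma abs_trace_add: "abs_trace (x + y) \<approx> abs_trace x + abs_trace y"
  unfolding abs_trace_def sum.distrib[symmetric] by (intro cong_sum frobenius_add)

lemma abs_trace_frobenius: "abs_trace (x ^ (p ^ j)) \<approx> abs_trace x ^ (p ^ j)"
proof -
  have "abs_trace (x ^ (p ^ j)) = (\<Sum>i<m. (x ^ (p ^ i)) ^ (p ^ j))"
    by (simp add: abs_trace_def mult.commute flip: power_mult)
  thus ?thesis unfolding abs_trace_def using cong_sym[OF frobenius_sum] by simp
qed

lemma abs_trace_in_prime_field:
  assumes b: "fixed b"
  shows "abs_trace b ^ p \<approx> abs_trace b"
proof -
  have "abs_trace b ^ p \<approx> (\<Sum>i<m. (b ^ (p ^ i)) ^ p)"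
    using frobenius_sum[of "\<lambda>i. b ^ (p ^ i)" "{..<m}" 1] by (simp add: abs_trace_def)
  also have "\<dots> = (\<Sum>i<m. b ^ (p ^ Suc i))" by (simp add: mult.commute flip: power_mult)
  also have "\<dots> = (\<Sum>i<Suc m. b ^ (p ^ i)) - b"
    by (subst sum.lessThan_Suc_shift) simp
  also have "\<dots> = abs_trace b + (b ^ q - b)" by (simp add: abs_trace_def q_def)
  also have "\<dots> \<approx> abs_trace b + 0"
    using b by (intro cong_add cong_refl) (simp add: fixed_def cong_diff_0)
  finally show ?thesis by simp
qed

text \<open>The absolute trace $F \to \mathbb{F}_p$, with values lifted to $\{0, \ldots, p - 1\}$ so that they can serve
  as exponents of an automorphism of order $p$.\<close>

definition trace_nat :: "'a \<Rightarrow> nat" where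
  "trace_nat b = (THE n. n < p \<and> of_nat n \<approx> abs_trace b)"

lemma trace_nat_eqI: "n < p \<Longrightarrow> of_nat n \<approx> abs_trace b \<Longrightarrow> trace_nat b = n"
  unfolding trace_nat_def by (rule the_equality) (auto intro: of_nat_cong_imp_eq[OF cong_trans[OF _ cong_sym]])

lemma trace_nat_less: "fixed b \<Longrightarrow> trace_nat b < p"
  and trace_nat_cong: "fixed b \<Longrightarrow> of_nat (trace_nat b) \<approx> abs_trace b"
  using frobenius_fixed_is_nat[OF abs_trace_in_prime_field] trace_nat_eqI by metis+

lemma trace_nat_add:
  assumes "fixed a" "fixed b"
  shows "trace_nat (rep (a + b)) mod p = (trace_nat a + trace_nat b) mod p"
proof -
  have f: "fixed (rep (a + b))" using fixed_add[OF assms] fixed_cong[OF rep_cong] by simp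
  have "of_nat (trace_nat (rep (a + b))) \<approx> abs_trace (rep (a + b))" by (rule trace_nat_cong[OF f])
  also have "\<dots> \<approx> abs_trace (a + b)" by (rule abs_trace_cong) simp
  also have "\<dots> \<approx> abs_trace a + abs_trace b" by (rule abs_trace_add)
  also have "\<dots> \<approx> of_nat (trace_nat a) + of_nat (trace_nat b)"
    using assms by (intro cong_add cong_sym[OF trace_nat_cong])
  finally have "of_nat (trace_nat (rep (a + b))) \<approx> of_nat (trace_nat a + trace_nat b)" by simp
  thus ?thesis unfolding of_nat_cong_iff mod_eq_dvd_iff[symmetric] zmod_int[symmetric] of_nat_eq_iff .
qed

lemma trace_nat_frobenius:
  assumes "fixed b"
  shows "trace_nat (rep (b ^ (p ^ j))) = trace_nat b"
proof (rule trace_nat_eqI[OF trace_nat_less[OF assms]])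
  have "of_nat (trace_nat b) \<approx> of_nat (trace_nat b) ^ (p ^ j)" by (rule cong_sym[OF of_nat_power_p])
  also have "\<dots> \<approx> abs_trace b ^ (p ^ j)" by (intro cong_power trace_nat_cong assms)
  also have "\<dots> \<approx> abs_trace (b ^ (p ^ j))" by (rule cong_sym[OF abs_trace_frobenius])
  also have "\<dots> \<approx> abs_trace (rep (b ^ (p ^ j)))" by (rule abs_trace_cong) simp
  finally show "of_nat (trace_nat b) \<approx> abs_trace (rep (b ^ (p ^ j)))" .
qed

lemma trace_nat_0: "trace_nat (rep 0) = 0"
proof (rule trace_nat_eqI)
  have "abs_trace 0 = 0" using p_gt_1 by (simp add: abs_trace_def power_0_left)
  moreover have "abs_trace (rep 0) \<approx> abs_trace 0" by (rule abs_trace_cong) simp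
  ultimately show "of_nat 0 \<approx> abs_trace (rep 0)" using cong_sym by simp
qed (use p_gt_1 in simp)

text \<open>The absolute trace is a polynomial function of degree $p^{m-1} < q$, so it cannot vanish on all of
  $F$.\<close>

lemma exists_trace_nonzero: obtains b where "b \<in> F" "0 < trace_nat b"
proof -
  have "\<exists>b\<in>F. trace_nat b \<noteq> 0"
  proof (rule ccontr)
    assume "\<not> ?thesis"
    hence z: "abs_trace b \<approx> 0" if "b \<in> F" for b
      using trace_nat_cong[of b] that cong_sym by (simp add: F_def)
    \<comment> \<open>the absolute trace polynomial without its leading term\<close>
    define g :: "'a poly" where "g = (\<Sum>i<m - 1. monom 1 (p ^ i))"
    have d: "degree g < p ^ (m - 1)"
      unfolding g_def using p_gt_1
      by (intro degree_sum_less) (auto simp: degree_monom_eq power_strict_increasing)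
    have "card F \<le> degree (monom 1 (p ^ (m - 1)) + g)"
    proof (rule card_roots_in_K_le[OF finite_K monic_monom_add(2)[OF d] F_subset_K])
      fix x assume "x \<in> F"
      have "poly (monom 1 (p ^ (m - 1)) + g) x = (\<Sum>i<Suc (m - 1). x ^ (p ^ i))"
        by (simp add: g_def poly_monom poly_sum add.commute)
      also have "\<dots> = abs_trace x" using m_pos by (simp add: abs_trace_def)
      also have "\<dots> \<approx> 0" using z[OF \<open>x \<in> F\<close>] .
      finally show "poly (monom 1 (p ^ (m - 1)) + g) x \<approx> 0" .
    qed
    hence "p ^ m \<le> p ^ (m - 1)" using monic_monom_add(1)[OF d] card_F by (simp add: q_def)
    moreover have "p ^ (m - 1) < p ^ m" using p_gt_1 m_pos by (intro power_strict_increasing) auto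
    ultimately show False by simp
  qed
  thus ?thesis using that by blast
qed

definition frob :: "nat \<Rightarrow> 'a \<times> 'a \<Rightarrow> 'a \<times> 'a" where
  "frob j x = (rep (fst x ^ (p ^ j)), rep (snd x ^ (p ^ j)))"

lemma fixed_power: "fixed x \<Longrightarrow> fixed (x ^ n)"
  unfolding fixed_def by (metis cong_power power_mult mult.commute)

lemma frob_closed: "x \<in> K \<times> F \<Longrightarrow> frob j x \<in> K \<times> F"
  by (auto simp: frob_def F_def intro: fixed_power) (metis fixed_cong fixed_power rep_cong)

lemma rep_power_rep: "rep (rep x ^ n) = rep (x ^ n)"
  by (simp add: rep_eq_iff cong_power)

lemma frob_frob: "frob i (frob j x) = frob (i + j) x"
  by (simp add: frob_def rep_power_rep power_add mult.commute flip: power_mult)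

lemma frob_shift:
  "frob j (shift (fst x) (snd x) y) = shift (fst (frob j x)) (snd (frob j x)) (frob j y)"
proof -
  have "rep (rep (u + v) ^ (p ^ j)) = rep (rep (u ^ (p ^ j)) + rep (v ^ (p ^ j)))" for u v
    unfolding rep_power_rep rep_add_rep unfolding rep_eq_iff by (rule frobenius_add)
  thus ?thesis by (simp add: frob_def shift_def)
qed

lemma power_eq_imp_cong:
  assumes "x ^ (p ^ j) \<approx> y ^ (p ^ j)"
  shows "x \<approx> y"
proof -
  have "(x - y) ^ (p ^ j) \<approx> x ^ (p ^ j) - y ^ (p ^ j)" by (rule frobenius_diff)
  also have "\<dots> \<approx> 0" using assms by (simp only: cong_diff_0)
  finally show ?thesis using p_gt_1 by (simp add: power_cong_0_iff cong_diff_0)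
qed

lemma inj_on_frob: "inj_on (frob j) (K \<times> F)"
proof (rule inj_onI)
  fix x y assume xy: "x \<in> K \<times> F" "y \<in> K \<times> F" "frob j x = frob j y"
  hence "fst x \<approx> fst y" "snd x \<approx> snd y" by (auto simp: frob_def rep_eq_iff intro: power_eq_imp_cong)
  thus "x = y" using xy(1,2) by (auto simp: F_def intro!: prod_eqI K_eqI)
qed

lemma bij_betw_frob: "bij_betw (frob j) (K \<times> F) (K \<times> F)"
proof -
  have "frob j ` (K \<times> F) = K \<times> F"
    using frob_closed by (intro endo_inj_surj inj_on_frob image_subsetI) auto
  thus ?thesis using inj_on_frob by (simp add: bij_betw_def)
qed

lemma denniston_subset: "denniston \<subseteq> K \<times> F"
  using axis_subset graphs_subset by (simp add: denniston_def)

text \<open>The set is described by the norm and by scalars in the prime field. The norm commutes with field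
  automorphisms and the scalars are fixed by them.\<close>

lemma frob_denniston: "frob j ` denniston = denniston"
proof (rule endo_inj_surj)
  show "finite denniston" using denniston_subset by (rule finite_subset) simp
  show "inj_on (frob j) denniston" using inj_on_frob denniston_subset by (rule inj_on_subset)
  show "frob j ` denniston \<subseteq> denniston"
  proof (rule image_subsetI)
    fix x assume x: "x \<in> denniston"
    obtain w l where [simp]: "x = (w, l)" by (cases x)
    have wl: "w \<in> K" "fixed l" using x denniston_subset by (auto simp: F_def)
    have pow_0: "y ^ (p ^ j) \<approx> 0 \<longleftrightarrow> y \<approx> 0" for y
      using p_gt_1 by (intro power_cong_0_iff) simp
    show "frob j x \<in> denniston"
    proof (cases "x \<in> axis")
      case True
      hence "w \<approx> 0" "\<not> l \<approx> 0" by (auto simp: axis_def)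
      hence "frob j x \<in> axis"
        using wl by (simp add: frob_def rep_pair_in_axis pow_0 fixed_power)
      thus ?thesis by (simp add: denniston_def)
    next
      case False
      hence "x \<in> graphs" using x by (simp add: denniston_def)
      then obtain c where c: "\<not> w \<approx> 0" "c \<in> scalars" "l \<approx> of_nat c * norm w" by (auto simp: graphs_def)
      have "l ^ (p ^ j) \<approx> (of_nat c * norm w) ^ (p ^ j)" using c(3) by (rule cong_power)
      also have "\<dots> = of_nat c ^ (p ^ j) * norm (w ^ (p ^ j))"
        by (simp add: norm_def power_mult_distrib mult.commute flip: power_mult)
      also have "\<dots> \<approx> of_nat c * norm (w ^ (p ^ j))" by (intro cong_mult of_nat_power_p cong_refl)
      finally have "frob j x \<in> graphs"
        using wl c(1,2) by (auto simp: frob_def rep_pair_in_graphs pow_0 fixed_power)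
      thus ?thesis by (simp add: denniston_def)
    qed
  qed
qed

lemma frob_period: "x \<in> K \<times> F \<Longrightarrow> frob (j + 2 * m * k) x = frob j x"
proof -
  have "y ^ (p ^ (2 * m * k)) \<approx> y" for y
  proof (induction k)
    case (Suc k)
    have "y ^ (p ^ (2 * m * Suc k)) = (y ^ (p ^ (2 * m))) ^ (p ^ (2 * m * k))"
      by (simp add: power_add flip: power_mult)
    also have "\<dots> \<approx> y ^ (p ^ (2 * m * k))" by (intro cong_power pow_card)
    finally show ?case using Suc cong_trans by blast
  qed simp
  hence "(y ^ (p ^ j)) ^ (p ^ (2 * m * k)) \<approx> y ^ (p ^ j)" for y by blast
  hence "rep (y ^ (p ^ (j + 2 * m * k))) = rep (y ^ (p ^ j))" for y
    by (simp add: rep_eq_iff power_add power_mult)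
  thus ?thesis by (simp add: frob_def)
qed

text \<open>The automorphism $x \mapsto x^{p^{2t}}$ has order $p$ when $m = pt$. An element of the additive group
  acts by the power of it that the absolute trace of the second coordinate prescribes.\<close>

definition twist :: "nat \<Rightarrow> 'a \<times> 'a \<Rightarrow> 'a \<times> 'a \<Rightarrow> 'a \<times> 'a" where
  "twist t x = frob (2 * t * trace_nat (snd x))"

lemma frob_exponent_cong:
  assumes m: "m = p * t" and ij: "i mod p = j mod p" and x: "x \<in> K \<times> F"
  shows "frob (2 * t * i) x = frob (2 * t * j) x"
proof -
  have *: "frob (2 * t * i) x = frob (2 * t * (i mod p)) x" for i
  proof -
    have "2 * t * i = 2 * t * (p * (i div p) + i mod p)" by simp
    also have "\<dots> = 2 * t * (i mod p) + 2 * m * (i div p)" by (simp only: m algebra_simps)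
    finally show ?thesis using frob_period[OF x] by simp
  qed
  show ?thesis using *[of i] *[of j] ij by simp
qed

text \<open>The absolute trace is additive and invariant under field automorphisms, so that the exponents of the
  two factors add up modulo $p$.\<close>

lemma twist_comp:
  assumes m: "m = p * t" and x: "x \<in> K \<times> F" and y: "y \<in> K \<times> F" and z: "z \<in> K \<times> F"
  shows "twist t (shift (fst x) (snd x) (twist t x y)) z = twist t x (twist t y z)"
proof -
  have f: "fixed (snd x)" "fixed (snd y)" using x y by (auto simp: F_def)
  have g: "twist t x y \<in> K \<times> F" unfolding twist_def using y by (rule frob_closed)
  have fg: "fixed (snd (twist t x y))" using g by (auto simp: F_def)
  have "trace_nat (snd (shift (fst x) (snd x) (twist t x y))) mod p =
      (trace_nat (snd x) + trace_nat (snd (twist t x y))) mod p"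
    unfolding shift_def snd_conv by (rule trace_nat_add[OF f(1) fg])
  also have "trace_nat (snd (twist t x y)) = trace_nat (snd y)"
    unfolding twist_def frob_def snd_conv by (rule trace_nat_frobenius[OF f(2)])
  finally have "twist t (shift (fst x) (snd x) (twist t x y)) z =
      frob (2 * t * (trace_nat (snd x) + trace_nat (snd y))) z"
    unfolding twist_def[of t "shift _ _ _"] by (rule frob_exponent_cong[OF m _ z])
  thus ?thesis by (simp add: twist_def frob_frob distrib_left)
qed

text \<open>For noncommutativity, compare $(w, 0)$ with $(0, b)$, where $b$ has nonzero trace $n$. If they
  commuted for every $w \in K$, then $x \mapsto x^{p^{2tn}}$ would fix all $p^{2m}$ elements of
  $K$, which is impossible because $2tn < 2m$.\<close>

lemma twisted_group_properties:
  assumes m: "m = p * t"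
  defines "G \<equiv> twisted_group additive_group (twist t)"
  shows "group G" and "\<not> comm_group G"
    and "partial_difference_set additive_group denniston v k l mu \<Longrightarrow> partial_difference_set G denniston v k l mu"
proof -
  interpret A: group additive_group by (rule additive_group_is_group)
  have sel: "carrier additive_group = K \<times> F" by (simp add: additive_group_def)
  have mult: "x \<otimes>\<^bsub>additive_group\<^esub> y = shift (fst x) (snd x) y" for x y by (simp add: additive_group_def)
  show grp: "group G"
    unfolding G_def
  proof (rule A.twisted_group_is_group, unfold sel mult)
    show "bij_betw (twist t x) (K \<times> F) (K \<times> F)" for x unfolding twist_def by (rule bij_betw_frob)
    show "twist t x (shift (fst y) (snd y) z) = shift (fst (twist t x y)) (snd (twist t x y)) (twist t x z)" for x y z
      unfolding twist_def by (rule frob_shift)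
  qed (rule twist_comp[OF m])
  show "partial_difference_set G denniston v k l mu" if "partial_difference_set additive_group denniston v k l mu"
    using that grp unfolding G_def
  proof (rule partial_difference_set_twisted_group)
    show "inj_on (twist t x) (carrier additive_group)" for x
      unfolding sel twist_def by (rule inj_on_frob)
    show "twist t x ` denniston = denniston" for x unfolding twist_def by (rule frob_denniston)
  qed
  show "\<not> comm_group G"
  proof
    assume "comm_group G"
    then interpret G: comm_group G .
    obtain b where b: "b \<in> F" "0 < trace_nat b" using exists_trace_nonzero .
    define j where "j = 2 * t * trace_nat b"
    have "w ^ (p ^ j) \<approx> w" if w: "w \<in> K" for w
    proof -
      have "(w, rep 0) \<otimes>\<^bsub>G\<^esub> (rep 0, b) = (rep 0, b) \<otimes>\<^bsub>G\<^esub> (w, rep 0)"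
        using w b by (intro G.m_comm) (auto simp: G_def twisted_group_def sel)
      hence "fst (shift w (rep 0) (frob 0 (rep 0, b))) = fst (shift (rep 0) b (frob j (w, rep 0)))"
        by (simp add: G_def twisted_group_def mult twist_def trace_nat_0 j_def)
      hence eq: "w + rep (rep 0) \<approx> rep 0 + rep (w ^ (p ^ j))"
        by (simp add: shift_def frob_def rep_eq_iff)
      have "w + rep (rep 0) \<approx> w + 0" by (rule cong_add[OF cong_refl]) simp
      moreover have "rep 0 + rep (w ^ (p ^ j)) \<approx> 0 + w ^ (p ^ j)" by (rule cong_add) simp_all
      ultimately have "w + 0 \<approx> 0 + w ^ (p ^ j)" using eq by (rule cong_iff[THEN iffD1])
      thus ?thesis using cong_sym by simp
    qed
    hence roots: "poly (monom 1 (p ^ j) + - monom 1 1) w \<approx> 0" if "w \<in> K" for w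
      using that by (simp add: poly_monom cong_diff_0)
    have "t > 0" using m m_pos by (cases t) auto
    hence j0: "j > 0" using b(2) by (simp add: j_def)
    have d: "degree (- monom 1 1 :: 'a poly) < p ^ j"
      using one_less_power[OF p_gt_1 j0] by (simp add: degree_monom_eq)
    have "card K \<le> degree (monom 1 (p ^ j) + - monom 1 1 :: 'a poly)"
      by (rule card_roots_in_K_le[OF finite_K monic_monom_add(2)[OF d] subset_refl roots])
    hence "p ^ (2 * m) \<le> p ^ j" using monic_monom_add(1)[OF d] card_K by simp
    moreover have "trace_nat b < p" using b(1) by (intro trace_nat_less) (simp add: F_def)
    hence "j < 2 * m" using \<open>t > 0\<close> by (simp add: j_def m)
    hence "p ^ j < p ^ (2 * m)" using p_gt_1 by (intro power_strict_increasing)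
    ultimately show False by simp
  qed
qed

end

theorem theorem6p8:
  fixes p m t :: nat
  assumes "prime p" and "odd p" and "t > 0" and "m = p * t"
  shows "\<exists>(G :: nat monoid) D. group G \<and> \<not> comm_group G \<and>
    partial_difference_set G D
      (p ^ (3 * m))
      ((p ^ m - 1) * ((p - 1) * (p ^ m + 1) + 1))
      (p ^ m - p + (p ^ (m + 1) - p ^ m + p) * (p - 2))
      ((p ^ (m + 1) - p ^ m + p) * (p - 1))"
proof -
  have m: "m > 0" using assms by (simp add: prime_gt_0_nat)
  obtain M :: "int poly set" where M: "residue_domain M p"
      "\<And>x. residue_domain.cong M (x ^ (p ^ (2 * m))) x" "card (residue_domain.K M) = p ^ (2 * m)"
    using exists_finite_residue_field[OF assms(1), of "2 * m"] m by auto
  interpret residue_domain M p by (rule M(1))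
  interpret quadratic_extension M p m by unfold_locales (use M m in auto)
  show ?thesis
    using partial_difference_set_copy_on_nat[OF twisted_group_properties(3)[OF assms(4)
        partial_difference_set_denniston] twisted_group_properties(2)[OF assms(4)]] .
qed

end
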